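(* Let $s$ be a fixed quadratic section. Two special $2$-fold coverings $\varphi,\varphi'\in\mathcal{E}(q)$ are $s$-related if and only if the derived matrices associated to $\varphi$ and $\varphi'$ are congruent.
   Context: Setting. $g\ge1$, $F_g$ is the closed oriented surface of genus $g$, and $S^1\hookrightarrow P\xrightarrow{p}F_g$ is a principal $S^1$-bundle with even Chern class $q=2c$. $\pi_1(F_g)=\langle x_1,\dots,x_{2g}\mid \prod_{j=1}^g[x_{2j-1},x_{2j}]\rangle$ is the standard presentation. $u_0\in\pi_1(P)$ is the image of a generator of $\pi_1(S^1)$ (the fiber), and $u_i\in\pi_1(P)$, $1\le i\le 2g$, are chosen with $p_\sharp(u_i)=x_i$, so that $\pi_1(P)=\langle u_0,u_1,\dots,u_{2g}\mid R_0,R_1,\dots,R_{2g}\rangle$ with $R_i=[u_i,u_0]$ ($1\le i\le 2g$) and $R_0=\prod_{\ell=1}^g[u_{2\ell-1},u_{2\ell}]\,u_0^{2c}$. Special coverings. $\mathcal{E}(q)$ is the set of homomorphisms $\varphi\colon\pi_1(P)\to\mathbb{Z}_2$ with $\varphi(u_0)=1$ (the nontrivial element of additive $\mathbb{Z}_2$); these are the monodromies of the special $2$-fold coverings of $P$. Let $h_P\colon\pi_1(P)\to H_1(P;\mathbb{Z}_2)$ and $h_{F_g}\colon\pi_1(F_g)\to H_1(F_g;\mathbb{Z}_2)$ be the mod $2$ Hurewicz maps. Each $\varphi\in\mathcal{E}(q)$ factors uniquely as $\varphi=\tilde\varphi\circ h_P$ with $\tilde\varphi\colon H_1(P;\mathbb{Z}_2)\to\mathbb{Z}_2$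 linear. Quadratic section and $s$-relation. Put $\sigma_i=h_{F_g}(x_i)$ (a symplectic basis of $H_1(F_g;\mathbb{Z}_2)$ for the mod $2$ intersection product "$\cdot$") and $\nu_i=h_P(u_i)$, $0\le i\le 2g$ (a basis of $H_1(P;\mathbb{Z}_2)$). Given $r_1,\dots,r_{2g}\in\mathbb{Z}_2$, the quadratic section $s$ is the unique map $s\colon H_1(F_g;\mathbb{Z}_2)\to H_1(P;\mathbb{Z}_2)$ with $s(\sigma_i)=\nu_i+r_i\nu_0$ for $1\le i\le 2g$ and $s(a+b)=s(a)+s(b)+(a\cdot b)\nu_0$ for all $a,b$. For a symplectic automorphism $f$ of $(H_1(F_g;\mathbb{Z}_2),\cdot)$, $f_s$ is the linear automorphism of $H_1(P;\mathbb{Z}_2)$ with $f_s(s(\sigma_i))=s(f(\sigma_i))$ for $1\le i\le 2g$ and $f_s(\nu_0)=\nu_0$. $\varphi,\varphi'$ are $s$-related if $\tilde\varphi=\tilde\varphi'\circ f_s$ for some symplectic $f$. The map $J$. For $A=(a_{ij})\in Sp(\mathbb{Z}_2,2g)$ (the matrix in the basis $(\sigma_i)$ of a symplectic $f$, $f(\sigma_j)=\sum_i a_{ij}\sigma_i$), $J(A)=\begin{pmatrix}A&0\\ W&1\end{pmatrix}$ where $W=(w_1,\dots,w_{2g})$, $w_j=\sum_{i=1}^{2g}a_{ij}r_i+\sum_{i=1}^{g}a_{2i,j}a_{2i-1,j}+r_j$; it is the matrix of $f_s$ in the basis $(\nu_1,\dots,\nu_{2g},\nu_0)$. Derived matrix.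 Let $\mathbb{Z}_2[\mathbb{Z}_2]=\mathbb{Z}_2[t]/(1-t^2)$; let $M_2\otimes\mathbb{Z}_2$ be the free $\mathbb{Z}_2[\mathbb{Z}_2]$-module with basis $\mathbf{R}=(R_1,\dots,R_{2g},R_0)$ and $M_1\otimes\mathbb{Z}_2$ the free module with basis $\mathbf{U}=(u_1,\dots,u_{2g},u_0)$. The derived matrix associated to $\varphi$ is the matrix in these bases of the linear map $d_\varphi\otimes\mathrm{id}_{\mathbb{Z}_2}\colon M_2\otimes\mathbb{Z}_2\to M_1\otimes\mathbb{Z}_2$, $R_i\mapsto\sum_j\varphi\!\left(\partial R_i/\partial u_j\right)u_j$, where $\partial/\partial u_j$ are Fox derivatives and $\varphi$ is extended to group rings, with target $\mathbb{Z}_2$ written multiplicatively as $\{1,t\}$ (so $\varphi(u_0)=t$). Explicitly, with $n_i=\varphi(u_i)\in\{0,1\}$, $\varepsilon(2k)=n_{2k-1}$, $\varepsilon(2k-1)=n_{2k}$, it is $(1+t)\begin{pmatrix}I_{2g}&\varepsilon\\ n&c\bmod 2\end{pmatrix}$, with $\varepsilon$ the column $(\varepsilon(1),\dots,\varepsilon(2g))^{T}$ and $n$ the row $(n_1,\dots,n_{2g})$. Congruence. The derived matrices of $\varphi$ and $\varphi'$ are congruent if there exist $\mathbb{Z}_2[\mathbb{Z}_2]$-isomorphisms $\psi\colon M_1\otimes\mathbb{Z}_2\to M_1\otimes\mathbb{Z}_2$ and $\theta\colon M_2\otimes\mathbb{Z}_2\to M_2\otimes\mathbb{Z}_2$ with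 $\psi\circ(d_\varphi\otimes\mathrm{id})=(d_{\varphi'}\otimes\mathrm{id})\circ\theta$, such that the matrix of $\psi$ in $\mathbf{U}$ is an element of $J(Sp(\mathbb{Z}_2,2g))$ and the matrix of $\theta$ in $\mathbf{R}$ has the form $\begin{pmatrix}B_1&B_2\\0&1\end{pmatrix}$ with $B_1$ of size $2g\times 2g$. *)

theory Defs
  imports
    "HOL-Algebra.Generated_Groups"
    "HOL-Library.Poly_Mapping"
    "HOL-Library.Z2"
    "Jordan_Normal_Form.Matrix"
begin

section \<open>Free groups, group rings and Fox derivatives\<close>

text \<open>
  The free group is written additively (as a non-commutative instance of \<^class>\<open>group_add\<close>).
  Convolution of \<^type>\<open>poly_mapping\<close> then makes \<open>'a free_group \<Rightarrow>\<^sub>0 int\<close> the integral group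
  ring of the free group, a group element \<open>w\<close> being \<open>Poly_Mapping.single w 1\<close>.
  A letter \<open>(i, True)\<close> stands for the generator \<open>i\<close>, and \<open>(i, False)\<close> for its inverse.
\<close>

inductive cancels :: "('a \<times> bool) list \<Rightarrow> ('a \<times> bool) list \<Rightarrow> bool" where
  "cancels (u @ (i, b) # (i, \<not> b) # v) (u @ v)"

quotient_type 'a free_group = "('a \<times> bool) list" / "equivclp cancels"
  by (rule equivp_evquivclp)

lemma equivclp_map:
  assumes "\<And>x y. r x y \<Longrightarrow> equivclp q (f x) (f y)" and "equivclp r x y"
  shows "equivclp q (f x) (f y)"
  using assms(2)
proof (induction rule: equivclp_induct)
  case base
  then show ?case by simp
next
  case (step y z)
  then show ?case
    by (metis assms(1) equivclp_sym equivclp_trans)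
qed

lemma cancels_append_left: "cancels x y \<Longrightarrow> cancels (z @ x) (z @ y)"
  by (elim cancels.cases) (metis append.assoc cancels.intros)

lemma cancels_append_right: "cancels x y \<Longrightarrow> cancels (x @ z) (y @ z)"
  by (elim cancels.cases) (metis append.assoc append_Cons cancels.intros)

definition inv_word :: "('a \<times> bool) list \<Rightarrow> ('a \<times> bool) list" where
  "inv_word w = rev (map (\<lambda>(i, b). (i, \<not> b)) w)"

lemma cancels_inv_word: "cancels x y \<Longrightarrow> cancels (inv_word x) (inv_word y)"
proof (elim cancels.cases)
  fix u v :: "('a \<times> bool) list" and i b
  assume "x = u @ (i, b) # (i, \<not> b) # v" "y = u @ v"
  then show ?thesis
    using cancels.intros[of "inv_word v" i b "inv_word u"] by (simp add: inv_word_def)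
qed

lemma inv_word_cancel: "equivclp cancels (inv_word w @ w) []"
proof (induction w)
  case Nil
  then show ?case by (simp add: inv_word_def)
next
  case (Cons a w)
  obtain i b where a: "a = (i, b)" by (cases a)
  have "cancels (inv_word w @ (i, \<not> b) # (i, \<not> \<not> b) # w) (inv_word w @ w)"
    by (rule cancels.intros)
  then have "cancels (inv_word (a # w) @ a # w) (inv_word w @ w)"
    by (simp add: inv_word_def a)
  then show ?case
    using Cons.IH by (meson equivclp_trans r_into_equivclp)
qed

instantiation free_group :: (type) group_add
begin

lift_definition zero_free_group :: "'a free_group" is "[]" .

lift_definition plus_free_group :: "'a free_group \<Rightarrow> 'a free_group \<Rightarrow> 'a free_group"
  is "(@)"
proof -
  fix x x' y y' :: "('a \<times> bool) list"
  assume x: "equivclp cancels x x'" and y: "equivclp cancels y y'"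
  have "equivclp cancels (x @ y) (x' @ y)"
    by (rule equivclp_map[OF _ x]) (simp add: cancels_append_right r_into_equivclp)
  moreover have "equivclp cancels (x' @ y) (x' @ y')"
    by (rule equivclp_map[OF _ y]) (simp add: cancels_append_left r_into_equivclp)
  ultimately show "equivclp cancels (x @ y) (x' @ y')"
    by (rule equivclp_trans)
qed

lift_definition uminus_free_group :: "'a free_group \<Rightarrow> 'a free_group" is inv_word
  by (rule equivclp_map) (auto intro: r_into_equivclp cancels_inv_word)

definition minus_free_group :: "'a free_group \<Rightarrow> 'a free_group \<Rightarrow> 'a free_group" where
  "minus_free_group x y = x + - y"

instance
proof
  fix a b c :: "'a free_group"
  show "a + b + c = a + (b + c)" by transfer simp
  show "0 + a = a" by transfer simp
  show "a + 0 = a" by transfer simp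
  show "- a + a = 0" by transfer (rule inv_word_cancel)
  show "a + - b = a - b" by (simp add: minus_free_group_def)
qed

end

lift_definition gen :: "'a \<Rightarrow> 'a free_group" is "\<lambda>i. [(i, True)]" .

fun fox_word :: "'a \<Rightarrow> ('a \<times> bool) list \<Rightarrow> 'a free_group \<Rightarrow>\<^sub>0 int" where
  "fox_word j [] = 0"
| "fox_word j ((i, True) # w) =
     (if i = j then 1 else 0) + Poly_Mapping.single (gen i) 1 * fox_word j w"
| "fox_word j ((i, False) # w) =
     Poly_Mapping.single (- gen i) 1 * (fox_word j w - (if i = j then 1 else 0))"

lemma fox_word_cancels: "cancels x y \<Longrightarrow> fox_word j x = fox_word j y"
proof (induction rule: cancels.induct)
  case (1 u i b v)
  have inverse: "Poly_Mapping.single g 1 * (Poly_Mapping.single h 1 * p) = p"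
    if "g + h = 0" for g h :: "'a free_group" and p :: "'a free_group \<Rightarrow>\<^sub>0 int"
    using that by (simp add: mult.assoc[symmetric] mult_single)
  show ?case
  proof (induction u)
    case Nil
    then show ?case by (cases b) (simp_all add: inverse)
  next
    case (Cons a u)
    then show ?case by (cases a, cases "snd a") auto
  qed
qed

lift_definition fox :: "'a \<Rightarrow> 'a free_group \<Rightarrow> 'a free_group \<Rightarrow>\<^sub>0 int" is fox_word
proof -
  fix j and x y :: "('a \<times> bool) list"
  assume "equivclp cancels x y"
  then show "fox_word j x = fox_word j y"
    by (induction rule: equivclp_induct) (auto dest: fox_word_cancels[where j = j])
qed

text \<open>The next two rules are the ones by which \<open>\<partial>/\<partial>u\<^sub>j\<close> is usually defined.\<close>

lemma fox_gen: "fox j (gen i) = (if i = j then 1 else 0)"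
  by transfer simp

lemma fox_add: "fox j (v + w) = fox j v + Poly_Mapping.single v 1 * fox j w"
proof -
  have pos: "fox j (gen i + y) = fox j (gen i) + Poly_Mapping.single (gen i) 1 * fox j y" for i y
    unfolding fox_gen
    by (induction y rule: free_group.abs_induct) (simp add: gen.abs_eq plus_free_group.abs_eq fox.abs_eq)
  have neg: "fox j (- gen i + y) = Poly_Mapping.single (- gen i) 1 * (fox j y - fox j (gen i))"
    for i y
    unfolding fox_gen
    by (induction y rule: free_group.abs_induct)
      (simp add: gen.abs_eq uminus_free_group.abs_eq plus_free_group.abs_eq fox.abs_eq inv_word_def)
  have zero: "abs_free_group [] = (0 :: 'a free_group)" "fox j (0 :: 'a free_group) = 0"
    by (simp_all add: zero_free_group_def fox.abs_eq)
  have letter: "abs_free_group ((i, b) # x) =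
      (if b then gen i else - gen i) + abs_free_group x" for i b and x :: "('a \<times> bool) list"
    by (simp add: gen.abs_eq uminus_free_group.abs_eq plus_free_group.abs_eq inv_word_def)
  have single: "Poly_Mapping.single (a + b) (1 :: int) =
      Poly_Mapping.single a 1 * Poly_Mapping.single b 1" for a b :: "'a free_group"
    by (simp add: mult_single)
  have "fox j (abs_free_group x + w) =
      fox j (abs_free_group x) + Poly_Mapping.single (abs_free_group x) 1 * fox j w" for x
  proof (induction x)
    case Nil
    then show ?case by (simp add: zero)
  next
    case (Cons a x)
    obtain i b where a: "a = (i, b)" by (cases a)
    show ?case
      by (cases b)
        (simp_all add: a letter add.assoc pos neg Cons.IH single distrib_left
          right_diff_distrib mult.assoc)
  qed
  then show ?thesis
    by (induction v rule: free_group.abs_induct) simp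
qed

definition group_ring_map :: "('a \<Rightarrow> 'b) \<Rightarrow> ('a \<Rightarrow>\<^sub>0 int) \<Rightarrow> ('b \<Rightarrow>\<^sub>0 'c::ring_1)" where
  "group_ring_map h a =
     (\<Sum>w\<in>Poly_Mapping.keys a. Poly_Mapping.single (h w) (of_int (Poly_Mapping.lookup a w)))"


section \<open>Presented groups and mod 2 homology\<close>

definition free_group_on :: "'a set \<Rightarrow> 'a free_group monoid" where
  "free_group_on I =
     (let F = \<lparr>carrier = UNIV, monoid.mult = (+), one = 0\<rparr>
      in F\<lparr>carrier := generate F (gen ` I)\<rparr>)"

definition normal_closure :: "('a, 'b) monoid_scheme \<Rightarrow> 'a set \<Rightarrow> 'a set" where
  "normal_closure G R =
     generate G {x \<otimes>\<^bsub>G\<^esub> r \<otimes>\<^bsub>G\<^esub> inv\<^bsub>G\<^esub> x | x r. x \<in> carrier G \<and> r \<in> R}"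

definition presented_group :: "'a set \<Rightarrow> 'a free_group set \<Rightarrow> 'a free_group set monoid" where
  "presented_group I R = free_group_on I Mod normal_closure (free_group_on I) R"

definition presented_class :: "'a set \<Rightarrow> 'a free_group set \<Rightarrow> 'a free_group \<Rightarrow> 'a free_group set" where
  "presented_class I R w = normal_closure (free_group_on I) R #>\<^bsub>free_group_on I\<^esub> w"

definition Z2 :: "bit monoid" where
  "Z2 = \<lparr>carrier = UNIV, monoid.mult = (+), one = 0\<rparr>"

text \<open>
  \<open>H\<^sub>1(X; \<int>\<^sub>2)\<close> of a connected space \<open>X\<close> with fundamental group \<open>G\<close> is \<open>G\<^sup>a\<^sup>b \<otimes> \<int>\<^sub>2\<close>, i.e. the
  quotient of \<open>G\<close> by the subgroup generated by all commutators and squares, and the mod 2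
  Hurewicz map is the projection.  The homology groups are thus multiplicative records;
  their \<open>\<int>\<^sub>2\<close>-linear maps are exactly the group homomorphisms.
\<close>

definition mod2_kernel :: "('a, 'b) monoid_scheme \<Rightarrow> 'a set" where
  "mod2_kernel G = generate G
     ({x \<otimes>\<^bsub>G\<^esub> y \<otimes>\<^bsub>G\<^esub> inv\<^bsub>G\<^esub> x \<otimes>\<^bsub>G\<^esub> inv\<^bsub>G\<^esub> y | x y. x \<in> carrier G \<and> y \<in> carrier G} \<union>
      {x \<otimes>\<^bsub>G\<^esub> x | x. x \<in> carrier G})"

definition H1 :: "('a, 'b) monoid_scheme \<Rightarrow> 'a set monoid" where
  "H1 G = G Mod mod2_kernel G"

definition hurewicz :: "('a, 'b) monoid_scheme \<Rightarrow> 'a \<Rightarrow> 'a set" where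
  "hurewicz G x = mod2_kernel G #>\<^bsub>G\<^esub> x"

text \<open>The linear map on \<open>H\<^sub>1\<close> through which a homomorphism \<open>\<phi>\<close> to \<open>\<int>\<^sub>2\<close> factors.\<close>

definition factor :: "('a, 'b) monoid_scheme \<Rightarrow> ('a \<Rightarrow> bit) \<Rightarrow> 'a set \<Rightarrow> bit" where
  "factor G \<phi> = (THE \<psi>. \<psi> \<in> hom (H1 G) Z2 \<inter> extensional (carrier (H1 G)) \<and>
     (\<forall>x\<in>carrier G. \<psi> (hurewicz G x) = \<phi> x))"

definition bit_scale :: "('a, 'b) monoid_scheme \<Rightarrow> bit \<Rightarrow> 'a \<Rightarrow> 'a" where
  "bit_scale V b x = (if b = 1 then x else \<one>\<^bsub>V\<^esub>)"


section \<open>The surface, the circle bundle and its special coverings\<close>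

text \<open>
  The surface \<open>F\<^sub>g\<close> and the total space \<open>P\<close> of the circle bundle over it with Chern class \<open>2c\<close>
  enter through the standard presentations of their fundamental groups: generator \<open>0\<close> of
  \<open>\<pi>\<^sub>1(P)\<close> is the class \<open>u\<^sub>0\<close> of the fibre, and generator \<open>i \<ge> 1\<close> is the chosen lift \<open>u\<^sub>i\<close> of \<open>x\<^sub>i\<close>.
\<close>

definition comm :: "'a free_group \<Rightarrow> 'a free_group \<Rightarrow> 'a free_group" where
  "comm a b = a + b - a - b"

definition zpow :: "'a free_group \<Rightarrow> int \<Rightarrow> 'a free_group" where
  "zpow a k = (if 0 \<le> k then sum_list (replicate (nat k) a)
               else - sum_list (replicate (nat (- k)) a))"

definition surface_word :: "nat \<Rightarrow> nat free_group" where
  "surface_word g = (\<Sum>l\<leftarrow>[1..<Suc g]. comm (gen (2 * l - 1)) (gen (2 * l)))"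

definition pi1_F :: "nat \<Rightarrow> nat free_group set monoid" where
  "pi1_F g = presented_group {1..2 * g} {surface_word g}"

definition x_gen :: "nat \<Rightarrow> nat \<Rightarrow> nat free_group set" where
  "x_gen g i = presented_class {1..2 * g} {surface_word g} (gen i)"

definition relator :: "nat \<Rightarrow> int \<Rightarrow> nat \<Rightarrow> nat free_group" where
  "relator g c i =
     (if i = 0 then surface_word g + zpow (gen 0) (2 * c) else comm (gen i) (gen 0))"

definition pi1_P :: "nat \<Rightarrow> int \<Rightarrow> nat free_group set monoid" where
  "pi1_P g c = presented_group {0..2 * g} (relator g c ` {0..2 * g})"

definition pi1_P_class :: "nat \<Rightarrow> int \<Rightarrow> nat free_group \<Rightarrow> nat free_group set" where
  "pi1_P_class g c = presented_class {0..2 * g} (relator g c ` {0..2 * g})"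

definition u_gen :: "nat \<Rightarrow> int \<Rightarrow> nat \<Rightarrow> nat free_group set" where
  "u_gen g c i = pi1_P_class g c (gen i)"

definition special_coverings :: "nat \<Rightarrow> int \<Rightarrow> (nat free_group set \<Rightarrow> bit) set" where
  "special_coverings g c = {\<phi> \<in> hom (pi1_P g c) Z2. \<phi> (u_gen g c 0) = 1}"


section \<open>Quadratic sections and the \<open>s\<close>-relation\<close>

definition sigma :: "nat \<Rightarrow> nat \<Rightarrow> nat free_group set set" where
  "sigma g i = hurewicz (pi1_F g) (x_gen g i)"

definition nu :: "nat \<Rightarrow> int \<Rightarrow> nat \<Rightarrow> nat free_group set set" where
  "nu g c i = hurewicz (pi1_P g c) (u_gen g c i)"

definition sigma_dual :: "nat \<Rightarrow> nat \<Rightarrow> nat free_group set set \<Rightarrow> bit" where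
  "sigma_dual g i = (THE \<xi>. \<xi> \<in> hom (H1 (pi1_F g)) Z2 \<inter> extensional (carrier (H1 (pi1_F g))) \<and>
     (\<forall>j\<in>{1..2 * g}. \<xi> (sigma g j) = of_bool (i = j)))"

text \<open>
  The mod 2 intersection product: \<open>\<sigma>\<^sub>1, \<dots>, \<sigma>\<^bsub>2g\<^esub>\<close> is a symplectic basis for it, with
  \<open>\<sigma>\<^bsub>2k-1\<^esub>\<close> dual to \<open>\<sigma>\<^bsub>2k\<^esub>\<close>.
\<close>

definition intersection ::
    "nat \<Rightarrow> nat free_group set set \<Rightarrow> nat free_group set set \<Rightarrow> bit" where
  "intersection g a b =
     (\<Sum>k\<in>{1..g}. sigma_dual g (2 * k - 1) a * sigma_dual g (2 * k) b
                + sigma_dual g (2 * k) a * sigma_dual g (2 * k - 1) b)"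

definition quadratic_section ::
    "nat \<Rightarrow> int \<Rightarrow> (nat \<Rightarrow> bit) \<Rightarrow> (nat free_group set set \<Rightarrow> nat free_group set set) \<Rightarrow> bool" where
  "quadratic_section g c r s \<longleftrightarrow>
     (let HF = H1 (pi1_F g); HP = H1 (pi1_P g c)
      in s \<in> carrier HF \<rightarrow> carrier HP \<and>
         (\<forall>i\<in>{1..2 * g}. s (sigma g i) = nu g c i \<otimes>\<^bsub>HP\<^esub> bit_scale HP (r i) (nu g c 0)) \<and>
         (\<forall>a\<in>carrier HF. \<forall>b\<in>carrier HF.
            s (a \<otimes>\<^bsub>HF\<^esub> b) =
              s a \<otimes>\<^bsub>HP\<^esub> s b \<otimes>\<^bsub>HP\<^esub> bit_scale HP (intersection g a b) (nu g c 0)))"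

definition symplectic_auts :: "nat \<Rightarrow> (nat free_group set set \<Rightarrow> nat free_group set set) set" where
  "symplectic_auts g =
     {f \<in> iso (H1 (pi1_F g)) (H1 (pi1_F g)).
        \<forall>a\<in>carrier (H1 (pi1_F g)). \<forall>b\<in>carrier (H1 (pi1_F g)).
          intersection g (f a) (f b) = intersection g a b}"

text \<open>\<open>fs\<close> is the linear automorphism \<open>f\<^sub>s\<close> induced by \<open>f\<close>.\<close>

definition induced_aut ::
    "nat \<Rightarrow> int \<Rightarrow> (nat free_group set set \<Rightarrow> nat free_group set set) \<Rightarrow>
     (nat free_group set set \<Rightarrow> nat free_group set set) \<Rightarrow>
     (nat free_group set set \<Rightarrow> nat free_group set set) \<Rightarrow> bool" where
  "induced_aut g c s f fs \<longleftrightarrow>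
     fs \<in> iso (H1 (pi1_P g c)) (H1 (pi1_P g c)) \<and>
     (\<forall>i\<in>{1..2 * g}. fs (s (sigma g i)) = s (f (sigma g i))) \<and>
     fs (nu g c 0) = nu g c 0"

definition s_related ::
    "nat \<Rightarrow> int \<Rightarrow> (nat free_group set set \<Rightarrow> nat free_group set set) \<Rightarrow>
     (nat free_group set \<Rightarrow> bit) \<Rightarrow> (nat free_group set \<Rightarrow> bit) \<Rightarrow> bool" where
  "s_related g c s \<phi> \<phi>' \<longleftrightarrow>
     (\<exists>f\<in>symplectic_auts g. \<exists>fs. induced_aut g c s f fs \<and>
        (\<forall>y\<in>carrier (H1 (pi1_P g c)).
           factor (pi1_P g c) \<phi> y = factor (pi1_P g c) \<phi>' (fs y)))"


section \<open>Derived matrices and congruence\<close>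

text \<open>
  Matrix indices start at \<open>0\<close>: row and column \<open>k\<close> belong to \<open>\<sigma>\<^bsub>k+1\<^esub>\<close>.
\<close>

definition intersection_mat :: "nat \<Rightarrow> bit mat" where
  "intersection_mat g =
     mat (2 * g) (2 * g) (\<lambda>(i, j). of_bool (i \<noteq> j \<and> i div 2 = j div 2))"

definition Sp :: "nat \<Rightarrow> bit mat set" where
  "Sp g = {A \<in> carrier_mat (2 * g) (2 * g).
             A\<^sup>T * intersection_mat g * A = intersection_mat g}"

definition J :: "nat \<Rightarrow> (nat \<Rightarrow> bit) \<Rightarrow> bit mat \<Rightarrow> bit mat" where
  "J g r A =
     four_block_mat A (0\<^sub>m (2 * g) 1)
       (mat 1 (2 * g) (\<lambda>(_, j).
          (\<Sum>i\<in>{1..2 * g}. A $$ (i - 1, j) * r i)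
          + (\<Sum>i\<in>{1..g}. A $$ (2 * i - 1, j) * A $$ (2 * i - 2, j))
          + r (j + 1)))
       (1\<^sub>m 1)"

text \<open>
  \<open>\<int>\<^sub>2[\<int>\<^sub>2]\<close> as the group ring of the additive group of \<^typ>\<open>bit\<close>; the element \<open>t\<close> is
  \<open>Poly_Mapping.single 1 1\<close>.
\<close>

type_synonym Z2Z2 = "bit \<Rightarrow>\<^sub>0 bit"

text \<open>
  The bases \<open>(R\<^sub>1, \<dots>, R\<^bsub>2g\<^esub>, R\<^sub>0)\<close> and \<open>(u\<^sub>1, \<dots>, u\<^bsub>2g\<^esub>, u\<^sub>0)\<close> are enumerated by \<open>0, \<dots>, 2g\<close>,
  so that \<open>M\<^sub>2 \<otimes> \<int>\<^sub>2\<close> and \<open>M\<^sub>1 \<otimes> \<int>\<^sub>2\<close> are both \<open>carrier_vec (2 * g + 1)\<close>.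
\<close>

definition basis_label :: "nat \<Rightarrow> nat \<Rightarrow> nat" where
  "basis_label g k = (if k < 2 * g then k + 1 else 0)"

definition derived_matrix :: "nat \<Rightarrow> int \<Rightarrow> (nat free_group set \<Rightarrow> bit) \<Rightarrow> Z2Z2 mat" where
  "derived_matrix g c \<phi> =
     mat (2 * g + 1) (2 * g + 1) (\<lambda>(j, i).
       group_ring_map (\<lambda>w. \<phi> (pi1_P_class g c w))
         (fox (basis_label g j) (relator g c (basis_label g i))))"

definition module_aut :: "nat \<Rightarrow> ('a::comm_ring_1 vec \<Rightarrow> 'a vec) \<Rightarrow> bool" where
  "module_aut n f \<longleftrightarrow>
     bij_betw f (carrier_vec n) (carrier_vec n) \<and>
     (\<forall>v\<in>carrier_vec n. \<forall>w\<in>carrier_vec n. f (v + w) = f v + f w) \<and>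
     (\<forall>a. \<forall>v\<in>carrier_vec n. f (a \<cdot>\<^sub>v v) = a \<cdot>\<^sub>v f v)"

definition matrix_of :: "nat \<Rightarrow> ('a::comm_ring_1 vec \<Rightarrow> 'a vec) \<Rightarrow> 'a mat" where
  "matrix_of n f = mat n n (\<lambda>(i, j). f (unit_vec n j) $ i)"

definition congruent_derived ::
    "nat \<Rightarrow> int \<Rightarrow> (nat \<Rightarrow> bit) \<Rightarrow>
     (nat free_group set \<Rightarrow> bit) \<Rightarrow> (nat free_group set \<Rightarrow> bit) \<Rightarrow> bool" where
  "congruent_derived g c r \<phi> \<phi>' \<longleftrightarrow>
     (\<exists>\<psi> \<theta>. module_aut (2 * g + 1) \<psi> \<and> module_aut (2 * g + 1) \<theta> \<and>
        (\<forall>v\<in>carrier_vec (2 * g + 1).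
           \<psi> (derived_matrix g c \<phi> *\<^sub>v v) = derived_matrix g c \<phi>' *\<^sub>v \<theta> v) \<and>
        matrix_of (2 * g + 1) \<psi> \<in> (\<lambda>A. map_mat (Poly_Mapping.single 0) (J g r A)) ` Sp g \<and>
        (\<exists>B1\<in>carrier_mat (2 * g) (2 * g). \<exists>B2\<in>carrier_mat (2 * g) 1.
           matrix_of (2 * g + 1) \<theta> = four_block_mat B1 B2 (0\<^sub>m 1 (2 * g)) (1\<^sub>m 1)))"

end

theory Submission
  imports Defs "Jordan_Normal_Form.Determinant"
begin

text \<open>
  Both relations reduce to one and the same affine equation over \<open>\<int>\<^sub>2\<close>.  Write \<open>n\<close> and \<open>n'\<close> for
  the rows \<open>(\<phi>(u\<^sub>1), \<dots>)\<close> and \<open>(\<phi>'(u\<^sub>1), \<dots>)\<close>, and \<open>W(A)\<close> for the lower left block of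
  \<open>J(A)\<close>.  Either relation holds if and only if \<open>n = n' A + W(A)\<close> for some symplectic \<open>A\<close>, that
  is, \<open>(n, 1) = (n', 1) J(A)\<close>.

  For the \<open>s\<close>-relation (lemma \<open>s_related_iff\<close>): the linear maps on \<open>H\<^sub>1(P; \<int>\<^sub>2)\<close> given by
  \<open>\<phi>\<close> and \<open>\<phi>'\<close> have the coordinate rows \<open>(n, 1)\<close> and \<open>(n', 1)\<close>, and \<open>f\<^sub>s\<close> has the matrix \<open>J(A)\<close>,
  where \<open>A\<close> is the matrix of \<open>f\<close>.  The entries of \<open>W(A)\<close> come from expanding the quadratic section
  on a linear combination of the \<open>\<sigma>\<^sub>i\<close> (lemma \<open>hom_quadratic_section\<close>).

  For congruence (lemma \<open>congruent_derived_iff\<close>): the derived matrix is \<open>1 + t\<close> times a block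
  matrix of bits with the blocks \<open>1\<close>, \<open>\<epsilon>\<close>, \<open>n\<close> and \<open>c\<close> (lemma \<open>derived_matrix_eq\<close>), and the
  multiples of \<open>1 + t\<close> form a copy of \<open>\<int>\<^sub>2\<close>.  So the congruence can be compared block by block.  The
  upper blocks determine the blocks of \<open>\<theta>\<close> up to the annihilator of \<open>1 + t\<close>; the lower left block is
  the equation above; the lower right block is then automatic, because \<open>n \<epsilon> = 0\<close>: the column
  \<open>\<epsilon>\<close> is \<open>\<Omega> n\<^sup>T\<close> for the matrix \<open>\<Omega>\<close> of the intersection product, which is alternating.

  The groups are given by presentations.  Every relator has even exponent sum in every generator, so
  all assignments of bits to the generators extend to homomorphisms into \<open>\<int>\<^sub>2\<close>, and the classes
  \<open>\<sigma>\<^sub>i\<close> and \<open>\<nu>\<^sub>i\<close> are bases of the mod 2 homology groups (lemma \<open>mod2_basis_H1_presented\<close>).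
\<close>

(* These two rules would turn sums and products of bits into Boolean operations, out of reach of
   the ring laws. *)
declare add_bit_eq_xor [simp del] mult_bit_eq_and [simp del]

section \<open>Homomorphisms to the group of two elements\<close>

lemma bit_add_self [simp]: "(a::bit) + a = 0"
  by (cases a) simp_all

lemma Z2_simps [simp]: "carrier Z2 = UNIV" "x \<otimes>\<^bsub>Z2\<^esub> y = x + y" "\<one>\<^bsub>Z2\<^esub> = 0"
  by (simp_all add: Z2_def)

lemma group_Z2: "group Z2"
  by (rule groupI) (auto simp: ac_simps intro: exI[of _ "_::bit"] bit_add_self)

lemma inv_Z2 [simp]: "inv\<^bsub>Z2\<^esub> x = x"
  by (rule group.inv_equality[OF group_Z2]) simp_all

lemma hom_Z2_iff:
  "\<chi> \<in> hom G Z2 \<longleftrightarrow> (\<forall>x\<in>carrier G. \<forall>y\<in>carrier G. \<chi> (x \<otimes>\<^bsub>G\<^esub> y) = \<chi> x + \<chi> y)"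
  by (simp add: hom_def)

lemma hom_Z2_one:
  assumes "group G" "\<chi> \<in> hom G Z2"
  shows "\<chi> \<one>\<^bsub>G\<^esub> = 0"
  using hom_one[OF assms(2,1) group_Z2] by simp

lemma hom_Z2_inv:
  assumes "group G" "\<chi> \<in> hom G Z2" "x \<in> carrier G"
  shows "\<chi> (inv\<^bsub>G\<^esub> x) = \<chi> x"
proof -
  interpret group G by fact
  have "\<chi> (inv\<^bsub>G\<^esub> x) + \<chi> x = \<chi> (inv\<^bsub>G\<^esub> x \<otimes>\<^bsub>G\<^esub> x)"
    using hom_mult[OF assms(2) inv_closed[OF assms(3)] assms(3)] by (simp only: Z2_simps)
  also have "\<dots> = 0"
    using assms(3) hom_Z2_one[OF assms(1,2)] by simp
  finally show ?thesis
    by (cases "\<chi> x"; cases "\<chi> (inv\<^bsub>G\<^esub> x)") auto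
qed

section \<open>Mod 2 homology of a presented group\<close>

text \<open>
  Conjugation is an automorphism, so it carries commutators to commutators and squares to squares.
\<close>

lemma mod2_kernel_normal:
  fixes G (structure)
  assumes "group G"
  shows "mod2_kernel G \<lhd> G"
proof -
  interpret group G by fact
  have conj: "g \<otimes> (a \<otimes> b) \<otimes> inv g = (g \<otimes> a \<otimes> inv g) \<otimes> (g \<otimes> b \<otimes> inv g)"
    if "g \<in> carrier G" "a \<in> carrier G" "b \<in> carrier G" for g a b
  proof -
    have "inv g \<otimes> (g \<otimes> x) = x" if "x \<in> carrier G" for x
      using that \<open>g \<in> carrier G\<close> by (simp flip: m_assoc)
    then show ?thesis
      using that by (simp add: m_assoc)
  qed
  have conj_inv: "g \<otimes> inv a \<otimes> inv g = inv (g \<otimes> a \<otimes> inv g)"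
    if "g \<in> carrier G" "a \<in> carrier G" for g a
    using that by (simp add: inv_mult_group m_assoc)
  show ?thesis
    unfolding mod2_kernel_def
  proof (rule normal_generateI, goal_cases)
    case 1
    then show ?case by auto
  next
    case (2 h g)
    from 2(1) show ?case
    proof (elim UnE CollectE exE conjE)
      fix x y assume h: "h = x \<otimes> y \<otimes> inv x \<otimes> inv y" and xy: "x \<in> carrier G" "y \<in> carrier G"
      have "g \<otimes> h \<otimes> inv g = (g \<otimes> x \<otimes> inv g) \<otimes> (g \<otimes> y \<otimes> inv g)
          \<otimes> inv (g \<otimes> x \<otimes> inv g) \<otimes> inv (g \<otimes> y \<otimes> inv g)"
        using xy 2(2) by (simp add: h conj_inv conj[of g "x \<otimes> y \<otimes> inv x" "inv y"]
            conj[of g "x \<otimes> y" "inv x"] conj[of g x y])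
      moreover have "g \<otimes> x \<otimes> inv g \<in> carrier G" "g \<otimes> y \<otimes> inv g \<in> carrier G"
        using xy 2(2) by simp_all
      ultimately show ?thesis
        by (intro UnI1 CollectI exI conjI)
    next
      fix x assume h: "h = x \<otimes> x" and x: "x \<in> carrier G"
      have "g \<otimes> h \<otimes> inv g = (g \<otimes> x \<otimes> inv g) \<otimes> (g \<otimes> x \<otimes> inv g)"
        using x 2(2) by (simp add: h conj[of g x x])
      moreover have "g \<otimes> x \<otimes> inv g \<in> carrier G"
        using x 2(2) by simp
      ultimately show ?thesis
        by (intro UnI2 CollectI exI conjI)
    qed
  qed
qed

lemma group_H1: "group G \<Longrightarrow> group (H1 G)"
  unfolding H1_def by (intro normal.factorgroup_is_group mod2_kernel_normal)

lemma hurewicz_hom: "group G \<Longrightarrow> hurewicz G \<in> hom G (H1 G)"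
  unfolding H1_def hurewicz_def by (intro normal.r_coset_hom_Mod mod2_kernel_normal)

lemma carrier_H1: "carrier (H1 G) = hurewicz G ` carrier G"
  by (simp add: H1_def hurewicz_def[abs_def] carrier_FactGroup)

lemma H1_square:
  fixes G (structure)
  assumes "group G" "x \<in> carrier (H1 G)"
  shows "x \<otimes>\<^bsub>H1 G\<^esub> x = \<one>\<^bsub>H1 G\<^esub>"
proof -
  interpret group G by fact
  obtain a where a: "a \<in> carrier G" "x = hurewicz G a"
    using assms(2) by (auto simp: carrier_H1)
  have K: "mod2_kernel G \<lhd> G" by (rule mod2_kernel_normal) fact
  have mem: "a \<otimes> a \<in> mod2_kernel G"
    using a unfolding mod2_kernel_def by (auto intro!: generate.incl)
  have "hurewicz G (a \<otimes> a) = mod2_kernel G"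
    unfolding hurewicz_def using a mem K by (intro coset_join2 normal_imp_subgroup) auto
  then show ?thesis
    using a hom_mult[OF hurewicz_hom[OF assms(1)], of a a] by (simp add: H1_def)
qed

text \<open>Being Abelian and of exponent 2, the group of bits kills commutators and squares.\<close>

lemma hom_factors_through_H1:
  fixes G (structure)
  assumes "group G" "\<phi> \<in> hom G Z2"
  obtains \<chi> where "\<chi> \<in> hom (H1 G) Z2" "\<And>x. x \<in> carrier G \<Longrightarrow> \<chi> (hurewicz G x) = \<phi> x"
proof -
  interpret group G by fact
  interpret h: group_hom G Z2 \<phi>
    using assms group_Z2 by (simp add: group_hom_def group_hom_axioms_def)
  have add: "\<phi> (x \<otimes> y) = \<phi> x + \<phi> y" if "x \<in> carrier G" "y \<in> carrier G" for x y
    using assms(2) that by (simp add: hom_Z2_iff)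
  have "mod2_kernel G \<subseteq> kernel G Z2 \<phi>"
    unfolding mod2_kernel_def
    by (rule generate_subgroup_incl[OF _ h.subgroup_kernel])
      (auto simp: kernel_def add hom_Z2_inv[OF assms] ac_simps)
  from h.FactGroup_universal_kernel[OF mod2_kernel_normal[OF assms(1)] this] that
  show ?thesis unfolding H1_def hurewicz_def by metis
qed

text \<open>
  The description in \<^const>\<open>factor\<close> is proper: a factorization exists, and on the carrier it is
  determined by \<open>\<phi>\<close> because the Hurewicz map is onto.
\<close>

lemma
  assumes "group G" "\<phi> \<in> hom G Z2"
  shows factor_hom: "factor G \<phi> \<in> hom (H1 G) Z2"
    and factor_hurewicz: "x \<in> carrier G \<Longrightarrow> factor G \<phi> (hurewicz G x) = \<phi> x"
proof -
  let ?P = "\<lambda>\<psi>. \<psi> \<in> hom (H1 G) Z2 \<inter> extensional (carrier (H1 G)) \<and>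
    (\<forall>x\<in>carrier G. \<psi> (hurewicz G x) = \<phi> x)"
  obtain \<chi> where \<chi>: "\<chi> \<in> hom (H1 G) Z2" "\<And>x. x \<in> carrier G \<Longrightarrow> \<chi> (hurewicz G x) = \<phi> x"
    using hom_factors_through_H1[OF assms] by blast
  have "?P (restrict \<chi> (carrier (H1 G)))"
    using \<chi> group.restrict_hom_iff[OF group_H1[OF assms(1)]]
    by (auto simp: hom_Z2_iff carrier_H1 group.subgroup_self
          monoid.m_closed[OF group.is_monoid[OF group_H1[OF assms(1)]], unfolded carrier_H1])
  moreover have "\<psi> = restrict \<chi> (carrier (H1 G))" if "?P \<psi>" for \<psi>
    using that \<chi> by (intro extensionalityI[of _ "carrier (H1 G)"]) (auto simp: carrier_H1)
  ultimately have "\<exists>!\<psi>. ?P \<psi>" by metis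
  from theI'[OF this] have "?P (factor G \<phi>)"
    unfolding factor_def .
  then show "factor G \<phi> \<in> hom (H1 G) Z2"
    and "x \<in> carrier G \<Longrightarrow> factor G \<phi> (hurewicz G x) = \<phi> x" by auto
qed

abbreviation free_group_UNIV :: "'a free_group monoid" where
  "free_group_UNIV \<equiv> \<lparr>carrier = UNIV, monoid.mult = (+), one = 0\<rparr>"

lemma group_free_group_UNIV: "group (free_group_UNIV :: 'a free_group monoid)"
  by (rule groupI) (auto simp: add.assoc intro: exI[of _ "- _"] left_minus)

lemma carrier_free_group_on: "carrier (free_group_on I) = generate free_group_UNIV (gen ` I)"
  by (simp add: free_group_on_def)

lemma free_group_on_simps [simp]:
  "x \<otimes>\<^bsub>free_group_on I\<^esub> y = x + y" "\<one>\<^bsub>free_group_on I\<^esub> = 0"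
  by (simp_all add: free_group_on_def)

lemma subgroup_free_group_on: "subgroup (carrier (free_group_on I)) free_group_UNIV"
  unfolding carrier_free_group_on
  by (rule group.generate_is_subgroup[OF group_free_group_UNIV]) simp

lemma free_group_on_alt: "free_group_on I = free_group_UNIV\<lparr>carrier := carrier (free_group_on I)\<rparr>"
  by (simp add: free_group_on_def)

lemma group_free_group_on: "group (free_group_on I)"
  using group.subgroup_imp_group[OF group_free_group_UNIV subgroup_free_group_on[of I]]
  unfolding free_group_on_alt[of I, symmetric] .

lemma generate_free_group_on: "generate (free_group_on I) (gen ` I) = carrier (free_group_on I)"
proof -
  have "gen ` I \<subseteq> carrier (free_group_on I)"
    by (auto simp: carrier_free_group_on intro: generate.incl)
  from group.generate_consistent[OF group_free_group_UNIV this subgroup_free_group_on]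
  show ?thesis
    unfolding free_group_on_alt[of I, symmetric] by (simp add: carrier_free_group_on)
qed

lemma inv_free_group_on:
  assumes "w \<in> carrier (free_group_on I)"
  shows "inv\<^bsub>free_group_on I\<^esub> w = - w"
proof -
  interpret group "free_group_on I" by (rule group_free_group_on)
  have "inv\<^bsub>free_group_on I\<^esub> w + w = 0"
    using assms l_inv by simp
  then show ?thesis by (simp add: eq_neg_iff_add_eq_0)
qed

lemma free_group_on_closed:
  shows gen_in_free_group_on: "i \<in> I \<Longrightarrow> gen i \<in> carrier (free_group_on I)"
    and zero_in_free_group_on: "0 \<in> carrier (free_group_on I)"
    and add_in_free_group_on: "v \<in> carrier (free_group_on I) \<Longrightarrow> w \<in> carrier (free_group_on I)
      \<Longrightarrow> v + w \<in> carrier (free_group_on I)"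
    and uminus_in_free_group_on: "v \<in> carrier (free_group_on I) \<Longrightarrow> - v \<in> carrier (free_group_on I)"
proof -
  interpret group "free_group_on I" by (rule group_free_group_on)
  show "i \<in> I \<Longrightarrow> gen i \<in> carrier (free_group_on I)"
    by (auto simp: carrier_free_group_on intro: generate.incl)
  show "0 \<in> carrier (free_group_on I)" using one_closed by simp
  show "v \<in> carrier (free_group_on I) \<Longrightarrow> w \<in> carrier (free_group_on I)
      \<Longrightarrow> v + w \<in> carrier (free_group_on I)" using m_closed by simp
  show "v \<in> carrier (free_group_on I) \<Longrightarrow> - v \<in> carrier (free_group_on I)"
    using inv_closed inv_free_group_on by metis
qed

text \<open>
  The homomorphism from the free group to \<open>\<int>\<^sub>2\<close> with the values \<open>v\<close> on the generators.  A letter and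
  its inverse count alike, since \<open>-1 = 1\<close> in \<open>\<int>\<^sub>2\<close>.
\<close>

lift_definition free_eval :: "('a \<Rightarrow> bit) \<Rightarrow> 'a free_group \<Rightarrow> bit" is
  "\<lambda>v w. \<Sum>(i, b)\<leftarrow>w. v i"
proof -
  fix v :: "'a \<Rightarrow> bit" and x y :: "('a \<times> bool) list"
  have *: "(\<Sum>(i, b)\<leftarrow>x. v i) = (\<Sum>(i, b)\<leftarrow>y. v i)" if "cancels x y" for x y
    using that by cases (simp flip: add.assoc)
  assume "equivclp cancels x y"
  then show "(\<Sum>(i, b)\<leftarrow>x. v i) = (\<Sum>(i, b)\<leftarrow>y. v i)"
    by (induction rule: equivclp_induct) (auto dest: *)
qed

lemma free_eval_gen [simp]: "free_eval v (gen i) = v i"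
  by transfer simp

lemma free_eval_add [simp]: "free_eval v (a + b) = free_eval v a + free_eval v b"
  by transfer simp

lemma free_eval_zero [simp]: "free_eval v 0 = 0"
  by transfer simp

lemma free_eval_uminus [simp]: "free_eval v (- a) = free_eval v a"
proof -
  have "free_eval v (- a) + free_eval v a = 0"
    using free_eval_add[of v "- a" a] by simp
  then show ?thesis
    by (cases "free_eval v a"; cases "free_eval v (- a)") auto
qed

lemma free_eval_diff [simp]: "free_eval v (a - b) = free_eval v a + free_eval v b"
  using free_eval_add[of v a "- b"] by simp

lemma normal_closure_normal:
  fixes G (structure)
  assumes "group G" "R \<subseteq> carrier G"
  shows "normal_closure G R \<lhd> G"
proof -
  interpret group G by fact
  show ?thesis
    unfolding normal_closure_def
  proof (rule normal_generateI, goal_cases)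
    case 1
    then show ?case using assms(2) by auto
  next
    case (2 h g)
    then obtain x r where h: "h = x \<otimes> r \<otimes> inv x" "x \<in> carrier G" "r \<in> R" by auto
    then have "g \<otimes> h \<otimes> inv g = (g \<otimes> x) \<otimes> r \<otimes> inv (g \<otimes> x)"
      using 2(2) assms(2) by (auto simp: inv_mult_group m_assoc)
    then show ?case using h 2(2) by blast
  qed
qed

context
  fixes I :: "'a set" and R :: "'a free_group set"
  assumes R: "R \<subseteq> carrier (free_group_on I)"
begin

lemma normal_relators: "normal_closure (free_group_on I) R \<lhd> free_group_on I"
  by (rule normal_closure_normal[OF group_free_group_on R])

lemma group_presented: "group (presented_group I R)"
  unfolding presented_group_def by (intro normal.factorgroup_is_group normal_relators)

lemma presented_class_hom: "presented_class I R \<in> hom (free_group_on I) (presented_group I R)"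
  unfolding presented_group_def presented_class_def[abs_def]
  by (intro normal.r_coset_hom_Mod normal_relators)

lemma carrier_presented:
  "carrier (presented_group I R) = presented_class I R ` carrier (free_group_on I)"
  by (simp add: presented_group_def presented_class_def[abs_def] carrier_FactGroup)

text \<open>
  A word with letters outside \<open>I\<close> does not represent an element of the group, and \<open>\<phi>\<close> may take any
  value on its class.  Fox calculus needs a function that is additive on all words; on the
  words that matter, this lemma replaces \<open>\<phi>\<close> by one.
\<close>

lemma presented_group_hom_eq_free_eval:
  assumes "\<phi> \<in> hom (presented_group I R) Z2" "w \<in> carrier (free_group_on I)"
  shows "\<phi> (presented_class I R w) = free_eval (\<lambda>i. \<phi> (presented_class I R (gen i))) w"
proof -
  have comp: "\<phi> \<circ> presented_class I R \<in> hom (free_group_on I) Z2"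
    by (rule hom_compose[OF presented_class_hom assms(1)])
  note gf = group_free_group_on[of I]
  have "(\<phi> \<circ> presented_class I R) w = free_eval (\<lambda>i. \<phi> (presented_class I R (gen i))) w"
    using assms(2)[folded generate_free_group_on]
  proof (induction rule: generate.induct)
    case one
    then show ?case using hom_Z2_one[OF gf comp] by simp
  next
    case (incl h)
    then show ?case by auto
  next
    case (inv h)
    then show ?case
      using hom_Z2_inv[OF gf comp, of h] by (auto simp: inv_free_group_on gen_in_free_group_on)
  next
    case (eng h1 h2)
    then show ?case
      using comp by (auto simp: hom_Z2_iff generate_free_group_on)
  qed
  then show ?thesis by simp
qed

lemma presented_group_hom_exists:
  assumes "\<And>w. w \<in> R \<Longrightarrow> free_eval v w = 0"
  obtains \<phi> where "\<phi> \<in> hom (presented_group I R) Z2"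
    "\<And>i. i \<in> I \<Longrightarrow> \<phi> (presented_class I R (gen i)) = v i"
proof -
  interpret group "free_group_on I" by (rule group_free_group_on)
  interpret h: group_hom "free_group_on I" Z2 "free_eval v"
    using group_Z2 by (simp add: group_hom_def group_hom_axioms_def group_free_group_on hom_Z2_iff)
  have "normal_closure (free_group_on I) R \<subseteq> kernel (free_group_on I) Z2 (free_eval v)"
    unfolding normal_closure_def
    using R assms
    by (intro generate_subgroup_incl[OF _ h.subgroup_kernel])
      (auto simp: kernel_def inv_free_group_on free_group_on_closed subset_iff
        simp del: add_uminus_conv_diff)
  from h.FactGroup_universal_kernel[OF normal_relators this] that
  show ?thesis
    unfolding presented_group_def presented_class_def
    by (metis free_eval_gen gen_in_free_group_on)
qed

lemma generate_H1_presented: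
  "carrier (H1 (presented_group I R)) =
     generate (H1 (presented_group I R))
       ((\<lambda>i. hurewicz (presented_group I R) (presented_class I R (gen i))) ` I)"
proof -
  let ?G = "presented_group I R" and ?k = "hurewicz (presented_group I R) \<circ> presented_class I R"
  have "?k \<in> hom (free_group_on I) (H1 ?G)"
    by (rule hom_compose[OF presented_class_hom hurewicz_hom[OF group_presented]])
  then interpret k: group_hom "free_group_on I" "H1 ?G" ?k
    using group_free_group_on group_H1[OF group_presented]
    by (simp add: group_hom_def group_hom_axioms_def)
  have "gen ` I \<subseteq> carrier (free_group_on I)" using gen_in_free_group_on by auto
  from k.generate_img[OF this] show ?thesis
    by (simp add: generate_free_group_on carrier_H1 carrier_presented image_image)
qed

end

section \<open>Coordinates on an elementary Abelian 2-group\<close>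

text \<open>
  An \<open>\<int>\<^sub>2\<close>-vector space with the basis \<open>e 0, \<dots>, e (n - 1)\<close>, as a multiplicative group.  Linear
  independence is expressed by the existence of linear forms with arbitrary values on the basis: this is
  what a presentation provides.
\<close>

locale mod2_basis = group V for V :: "('a, 'b) monoid_scheme" (structure) +
  fixes e :: "nat \<Rightarrow> 'a" and n :: nat
  assumes square: "x \<in> carrier V \<Longrightarrow> x \<otimes> x = \<one>"
    and span: "carrier V = generate V (e ` {..<n})"
    and hom_with_values: "\<exists>\<chi>\<in>hom V Z2. \<forall>j<n. \<chi> (e j) = v j"
begin

lemma inv_eq: "x \<in> carrier V \<Longrightarrow> inv x = x"
  using square by (simp add: inv_equality)

sublocale comm_group V
proof
  fix x y assume xy: "x \<in> carrier V" "y \<in> carrier V"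
  have "x \<otimes> y = inv (x \<otimes> y)"
    using xy inv_eq by simp
  also have "\<dots> = y \<otimes> x"
    unfolding inv_mult_group[OF xy] using xy by (simp add: inv_eq)
  finally show "x \<otimes> y = y \<otimes> x" .
qed

lemma e_closed [simp]: "i < n \<Longrightarrow> e i \<in> carrier V"
  unfolding span by (auto intro: generate.incl)

lemma span_induct [consumes 1, case_names one basis mult]:
  assumes "x \<in> carrier V" and "P \<one>" and basis: "\<And>i. i < n \<Longrightarrow> P (e i)"
    and mult: "\<And>x y. x \<in> carrier V \<Longrightarrow> y \<in> carrier V \<Longrightarrow> P x \<Longrightarrow> P y \<Longrightarrow> P (x \<otimes> y)"
  shows "P x"
  using assms(1)[unfolded span]
proof (induction rule: generate.induct)
  case (inv h)
  then show ?case by (auto simp: inv_eq basis)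
next
  case (eng h1 h2)
  then show ?case by (intro mult) (auto simp: span)
qed (use assms in auto)

lemma hom_eqI:
  assumes "\<chi> \<in> hom V Z2" "\<chi>' \<in> hom V Z2" "\<And>i. i < n \<Longrightarrow> \<chi> (e i) = \<chi>' (e i)"
    and "x \<in> carrier V"
  shows "\<chi> x = \<chi>' x"
  using assms(4)
proof (induction rule: span_induct)
  case one
  then show ?case using assms(1,2)[THEN hom_Z2_one[OF group_axioms]] by simp
qed (use assms in \<open>auto simp: hom_Z2_iff\<close>)

text \<open>
  The description has the form of that of \<^const>\<open>sigma_dual\<close>, so that the two agree on the homology of
  the surface by a mere shift of indices.
\<close>

definition coord :: "nat \<Rightarrow> 'a \<Rightarrow> bit" where
  "coord i = (THE \<xi>. \<xi> \<in> hom V Z2 \<inter> extensional (carrier V) \<and> (\<forall>j<n. \<xi> (e j) = of_bool (i = j)))"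

lemma coord_hom: "coord i \<in> hom V Z2"
  and coord_basis [simp]: "j < n \<Longrightarrow> coord i (e j) = of_bool (i = j)"
proof -
  let ?P = "\<lambda>\<xi>. \<xi> \<in> hom V Z2 \<inter> extensional (carrier V) \<and> (\<forall>j<n. \<xi> (e j) = of_bool (i = j))"
  obtain \<chi> where \<chi>: "\<chi> \<in> hom V Z2" "\<And>j. j < n \<Longrightarrow> \<chi> (e j) = of_bool (i = j)"
    using hom_with_values[of "\<lambda>j. of_bool (i = j)"] by auto
  have restricted: "?P (restrict \<chi> (carrier V))"
    using \<chi> by (auto simp: hom_Z2_iff)
  have unique: "\<psi> = restrict \<chi> (carrier V)" if "?P \<psi>" for \<psi>
  proof (rule extensionalityI[of _ "carrier V"])
    fix x assume x: "x \<in> carrier V"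
    have "\<psi> x = \<chi> x"
      by (rule hom_eqI) (use that \<chi> x in auto)
    then show "\<psi> x = restrict \<chi> (carrier V) x" using x by simp
  qed (use that in auto)
  from theI'[of ?P, OF ex1I[of ?P, OF restricted unique]] have "?P (coord i)"
    unfolding coord_def .
  then show "coord i \<in> hom V Z2" "j < n \<Longrightarrow> coord i (e j) = of_bool (i = j)" by auto
qed

lemma coord_mult [simp]:
  "x \<in> carrier V \<Longrightarrow> y \<in> carrier V \<Longrightarrow> coord i (x \<otimes> y) = coord i x + coord i y"
  using coord_hom by (simp add: hom_Z2_iff)

lemma coord_one [simp]: "coord i \<one> = 0"
  by (rule hom_Z2_one[OF group_axioms coord_hom])

definition coords :: "'a \<Rightarrow> bit vec" where
  "coords x = vec n (\<lambda>i. coord i x)"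

lemma coords_carrier [simp]: "coords x \<in> carrier_vec n" "dim_vec (coords x) = n"
  by (simp_all add: coords_def)

lemma coords_nth [simp]: "i < n \<Longrightarrow> coords x $ i = coord i x"
  by (simp add: coords_def)

lemma coords_mult:
  "x \<in> carrier V \<Longrightarrow> y \<in> carrier V \<Longrightarrow> coords (x \<otimes> y) = coords x + coords y"
  by (auto simp: coords_def)

lemma coords_basis: "j < n \<Longrightarrow> coords (e j) = unit_vec n j"
  by (auto simp: coords_def unit_vec_def)

lemma bit_scale_closed [simp]: "x \<in> carrier V \<Longrightarrow> bit_scale V b x \<in> carrier V"
  by (simp add: bit_scale_def)

lemma bit_scale_add:
  "x \<in> carrier V \<Longrightarrow> bit_scale V (a + b) x = bit_scale V a x \<otimes> bit_scale V b x"
  by (cases a; cases b) (simp_all add: bit_scale_def square)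

lemma hom_bit_scale:
  "\<chi> \<in> hom V Z2 \<Longrightarrow> \<chi> (bit_scale V b x) = b * \<chi> x"
  using hom_Z2_one[OF group_axioms] by (cases b) (simp_all add: bit_scale_def)

lemma hom_finprod:
  assumes "\<chi> \<in> hom V Z2" "finite A" "f \<in> A \<rightarrow> carrier V"
  shows "\<chi> (finprod V f A) = (\<Sum>i\<in>A. \<chi> (f i))"
  using assms(2,3)
proof (induction A rule: finite_induct)
  case empty
  then show ?case using hom_Z2_one[OF group_axioms assms(1)] by simp
next
  case (insert a A)
  then show ?case
    using assms(1) by (auto simp: hom_Z2_iff Pi_def)
qed

definition comb :: "bit vec \<Rightarrow> 'a" where
  "comb v = (\<Otimes>i\<in>{..<n}. bit_scale V (v $ i) (e i))"

lemma comb_closed [simp]: "comb v \<in> carrier V"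
  unfolding comb_def by (rule finprod_closed) auto

lemma comb_add:
  assumes "v \<in> carrier_vec n" "w \<in> carrier_vec n"
  shows "comb (v + w) = comb v \<otimes> comb w"
proof -
  have "comb (v + w) = (\<Otimes>i\<in>{..<n}. bit_scale V (v $ i) (e i) \<otimes> bit_scale V (w $ i) (e i))"
    unfolding comb_def using assms by (intro finprod_cong') (auto simp: bit_scale_add)
  also have "\<dots> = comb v \<otimes> comb w"
    unfolding comb_def by (intro finprod_multf) auto
  finally show ?thesis .
qed

lemma coords_comb:
  assumes "v \<in> carrier_vec n"
  shows "coords (comb v) = v"
proof (rule eq_vecI)
  fix i assume "i < dim_vec v"
  then have i: "i < n" using assms by simp
  have "coord i (comb v) = (\<Sum>j<n. v $ j * coord i (e j))"
    unfolding comb_def by (subst hom_finprod[OF coord_hom]) (auto simp: hom_bit_scale[OF coord_hom])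
  also have "\<dots> = (\<Sum>j<n. if j = i then v $ j else 0)"
    by (intro sum.cong) auto
  finally show "coords (comb v) $ i = v $ i" using i by simp
qed (use assms in simp)

text \<open>
  Both sides are additive in \<open>x\<close>, and they agree on the basis.
\<close>

lemma comb_coords: "x \<in> carrier V \<Longrightarrow> comb (coords x) = x"
proof (induction rule: span_induct)
  case one
  have "coords \<one> = 0\<^sub>v n" by (auto simp: coords_def)
  then show ?case
    by (auto simp: comb_def bit_scale_def intro!: finprod_one_eqI)
next
  case (basis i)
  have "comb (coords (e i)) = (\<Otimes>j\<in>{..<n}. if i = j then e j else \<one>)"
    unfolding comb_def using basis by (intro finprod_cong') (auto simp: bit_scale_def of_bool_def)
  also have "\<dots> = e i"
    using basis by (intro finprod_singleton) auto
  finally show ?case .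
next
  case (mult x y)
  then show ?case by (simp add: coords_mult comb_add)
qed

lemma coords_eqI: "x \<in> carrier V \<Longrightarrow> y \<in> carrier V \<Longrightarrow> coords x = coords y \<Longrightarrow> x = y"
  using comb_coords by metis

lemma hom_expand:
  assumes "\<chi> \<in> hom V Z2" "x \<in> carrier V"
  shows "\<chi> x = (\<Sum>i<n. coord i x * \<chi> (e i))"
proof -
  have "\<chi> x = \<chi> (comb (coords x))"
    using assms comb_coords by simp
  also have "\<dots> = (\<Sum>i<n. coord i x * \<chi> (e i))"
    unfolding comb_def by (subst hom_finprod[OF assms(1)]) (auto simp: hom_bit_scale[OF assms(1)])
  finally show ?thesis .
qed

text \<open>
  The endomorphism with the matrix \<open>M\<close>.  It provides \<open>f\<close> and \<open>f\<^sub>s\<close> from the matrices \<open>A\<close> and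
  \<open>J(A)\<close>.
\<close>

definition mat_action :: "bit mat \<Rightarrow> 'a \<Rightarrow> 'a" where
  "mat_action M x = comb (M *\<^sub>v coords x)"

lemma mat_action_closed [simp]: "mat_action M x \<in> carrier V"
  by (simp add: mat_action_def)

lemma coords_mat_action:
  assumes "M \<in> carrier_mat n n"
  shows "coords (mat_action M x) = M *\<^sub>v coords x"
  unfolding mat_action_def using assms by (intro coords_comb) auto

lemma mat_action_iso:
  assumes M: "M \<in> carrier_mat n n" "M' \<in> carrier_mat n n" and inv: "M' * M = 1\<^sub>m n" "M * M' = 1\<^sub>m n"
  shows "mat_action M \<in> iso V V"
proof (rule isoI)
  show "mat_action M \<in> hom V V"
    using M by (auto simp: hom_def mat_action_def coords_mult mult_add_distrib_mat_vec[of _ n n]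
        intro!: comb_add[THEN trans])
  have "mat_action N (mat_action N' x) = x"
    if "N \<in> carrier_mat n n" "N' \<in> carrier_mat n n" "N * N' = 1\<^sub>m n" "x \<in> carrier V" for N N' x
    using that by (intro coords_eqI)
      (auto simp: coords_mat_action simp flip: assoc_mult_mat_vec[of N n n N' n])
  then show "bij_betw (mat_action M) (carrier V) (carrier V)"
    using M inv by (intro bij_betw_byWitness[of _ "mat_action M'"]) auto
qed

end

text \<open>
  Relators that vanish under all assignments of bits impose no condition mod 2, so the classes of the
  generators remain independent.  The bijection \<open>l\<close> enumerates the generators from \<open>0\<close>, as matrix
  indices do.
\<close>

lemma mod2_basis_H1_presented:
  assumes I: "bij_betw l {..<n} I" and R: "R \<subseteq> carrier (free_group_on I)"
    and trivial: "\<And>v w. w \<in> R \<Longrightarrow> free_eval v w = 0"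
  shows "mod2_basis (H1 (presented_group I R))
    (\<lambda>k. hurewicz (presented_group I R) (presented_class I R (gen (l k)))) n"
proof -
  let ?G = "presented_group I R" and ?e = "\<lambda>i. hurewicz (presented_group I R) (presented_class I R (gen i))"
  have G: "group ?G" by (rule group_presented[OF R])
  interpret group "H1 ?G" by (rule group_H1[OF G])
  have image: "(\<lambda>k. ?e (l k)) ` {..<n} = ?e ` I"
    using I by (force simp: bij_betw_def)
  show ?thesis
  proof
    show "x \<otimes>\<^bsub>H1 ?G\<^esub> x = \<one>\<^bsub>H1 ?G\<^esub>" if "x \<in> carrier (H1 ?G)" for x
      using G that by (rule H1_square)
    show "carrier (H1 ?G) = generate (H1 ?G) ((\<lambda>k. ?e (l k)) ` {..<n})"
      unfolding image by (rule generate_H1_presented[OF R])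
    show "\<exists>\<chi>\<in>hom (H1 ?G) Z2. \<forall>j<n. \<chi> (?e (l j)) = v j" for v
    proof -
      obtain \<phi> where \<phi>: "\<phi> \<in> hom ?G Z2"
        "\<And>i. i \<in> I \<Longrightarrow> \<phi> (presented_class I R (gen i)) = v (the_inv_into {..<n} l i)"
        by (rule presented_group_hom_exists[OF R trivial,
              where v = "\<lambda>i. v (the_inv_into {..<n} l i)"]) (assumption, rule that)
      obtain \<chi> where \<chi>: "\<chi> \<in> hom (H1 ?G) Z2"
        "\<And>x. x \<in> carrier ?G \<Longrightarrow> \<chi> (hurewicz ?G x) = \<phi> x"
        by (rule hom_factors_through_H1[OF G \<phi>(1)]) (rule that)
      have "\<chi> (?e (l j)) = v j" if "j < n" for j
      proof -
        have "l j \<in> I" using I that by (auto simp: bij_betw_def)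
        moreover have "the_inv_into {..<n} l (l j) = j"
          using I that by (intro the_inv_into_f_f) (auto simp: bij_betw_def)
        ultimately show ?thesis
          using \<chi>(2) \<phi>(2) by (simp add: carrier_presented[OF R] gen_in_free_group_on)
      qed
      then show ?thesis using \<chi>(1) by blast
    qed
  qed
qed

section \<open>The homology of the surface and of the bundle\<close>

lemma free_eval_sum_list: "free_eval v (\<Sum>x\<leftarrow>xs. f x) = (\<Sum>x\<leftarrow>xs. free_eval v (f x))"
  by (induction xs) simp_all

lemma free_eval_comm [simp]: "free_eval v (comm a b) = 0"
proof -
  have "free_eval v (comm a b) =
      (free_eval v a + free_eval v a) + (free_eval v b + free_eval v b)"
    by (simp add: comm_def ac_simps del: bit_add_self)
  then show ?thesis by simp
qed

lemma free_eval_surface_word [simp]: "free_eval v (surface_word g) = 0"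
  by (simp add: surface_word_def free_eval_sum_list o_def)

lemma free_eval_zpow_even [simp]: "free_eval v (zpow a (2 * c)) = 0"
proof -
  have "(\<Sum>x\<leftarrow>replicate (2 * m) a. free_eval v x) = 0" for m
    by (simp add: sum_list_replicate)
  moreover have "nat (2 * c) = 2 * nat c" "nat (- (2 * c)) = 2 * nat (- c)" by simp_all
  ultimately show ?thesis
    by (simp add: zpow_def free_eval_sum_list[of v "\<lambda>x. x", simplified] del: mult_minus_right)
qed

lemma sum_list_in_free_group_on:
  "(\<And>x. x \<in> set xs \<Longrightarrow> f x \<in> carrier (free_group_on I)) \<Longrightarrow>
    (\<Sum>x\<leftarrow>xs. f x) \<in> carrier (free_group_on I)"
  by (induction xs) (simp_all add: free_group_on_closed)

lemma comm_in_free_group_on: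
  assumes "a \<in> carrier (free_group_on I)" "b \<in> carrier (free_group_on I)"
  shows "comm a b \<in> carrier (free_group_on I)"
  unfolding comm_def diff_conv_add_uminus using assms
  by (intro add_in_free_group_on uminus_in_free_group_on)

lemma surface_word_in_free_group_on:
  "{1..2 * g} \<subseteq> I \<Longrightarrow> surface_word g \<in> carrier (free_group_on I)"
  unfolding surface_word_def
  by (intro sum_list_in_free_group_on comm_in_free_group_on gen_in_free_group_on) force+

lemma zpow_in_free_group_on:
  "a \<in> carrier (free_group_on I) \<Longrightarrow> zpow a k \<in> carrier (free_group_on I)"
  using sum_list_in_free_group_on[of "replicate m a" "\<lambda>x. x" I for m]
  by (auto simp: zpow_def intro: uminus_in_free_group_on)

lemma relator_in_free_group_on:
  assumes "i \<le> 2 * g"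
  shows "relator g c i \<in> carrier (free_group_on {0..2 * g})"
  unfolding relator_def using assms
  by (auto intro!: add_in_free_group_on surface_word_in_free_group_on zpow_in_free_group_on
      comm_in_free_group_on gen_in_free_group_on)

lemma relators_in_free_group_on:
  "relator g c ` {0..2 * g} \<subseteq> carrier (free_group_on {0..2 * g})"
  using relator_in_free_group_on by auto

lemma bij_betw_basis_label: "bij_betw (basis_label g) {..<Suc (2 * g)} {0..2 * g}"
  by (rule bij_betw_byWitness[where f' = "\<lambda>i. if i = 0 then 2 * g else i - 1"])
    (auto simp: basis_label_def split: if_splits)

lemma mod2_basis_F: "mod2_basis (H1 (pi1_F g)) (\<lambda>k. sigma g (Suc k)) (2 * g)"
proof -
  have "bij_betw Suc {..<2 * g} {1..2 * g}"
    by (rule bij_betw_byWitness[where f' = "\<lambda>i. i - 1"]) auto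
  then show "mod2_basis (H1 (pi1_F g)) (\<lambda>k. sigma g (Suc k)) (2 * g)"
    unfolding pi1_F_def sigma_def x_gen_def
    by (rule mod2_basis_H1_presented) (auto intro: surface_word_in_free_group_on)
qed

interpretation HF: mod2_basis "H1 (pi1_F g)" "\<lambda>k. sigma g (Suc k)" "2 * g" for g
  by (rule mod2_basis_F)

text \<open>
  Evenness of the Chern class enters here: otherwise the relator \<open>R\<^sub>0\<close> would force \<open>\<nu>\<^sub>0 = 0\<close>.
\<close>

lemma mod2_basis_P:
  "mod2_basis (H1 (pi1_P g c)) (\<lambda>k. nu g c (basis_label g k)) (Suc (2 * g))"
  unfolding pi1_P_def nu_def u_gen_def pi1_P_class_def
  using bij_betw_basis_label relators_in_free_group_on
  by (rule mod2_basis_H1_presented) (auto simp: relator_def)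

interpretation HP: mod2_basis "H1 (pi1_P g c)" "\<lambda>k. nu g c (basis_label g k)" "Suc (2 * g)" for g c
  by (rule mod2_basis_P)

lemma group_pi1_P: "group (pi1_P g c)"
  unfolding pi1_P_def by (rule group_presented[OF relators_in_free_group_on])

lemma u_gen_in_pi1_P: "i \<le> 2 * g \<Longrightarrow> u_gen g c i \<in> carrier (pi1_P g c)"
  unfolding pi1_P_def u_gen_def pi1_P_class_def carrier_presented[OF relators_in_free_group_on]
  by (rule imageI, rule gen_in_free_group_on) simp

lemma sigma_dual_eq_coord: "sigma_dual g (Suc k) = HF.coord g k"
proof -
  have "(\<forall>j\<in>{1..2 * g}. \<xi> (sigma g j) = of_bool (Suc k = j)) \<longleftrightarrow>
      (\<forall>j<2 * g. \<xi> (sigma g (Suc j)) = of_bool (k = j))" for \<xi> :: "nat free_group set set \<Rightarrow> bit"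
    unfolding image_Suc_lessThan[symmetric] by auto
  then show ?thesis
    unfolding sigma_dual_def HF.coord_def by simp
qed

section \<open>The intersection form\<close>

text \<open>
  With indices from \<open>0\<close>, the basis vectors \<open>2k\<close> and \<open>2k + 1\<close> are dual to each other for the
  intersection product.
\<close>

definition partner :: "nat \<Rightarrow> nat" where
  "partner i = (if even i then i + 1 else i - 1)"

lemma partner_lt: "i < 2 * g \<Longrightarrow> partner i < 2 * g"
  unfolding partner_def by presburger

lemma intersection_mat_carrier [simp]: "intersection_mat g \<in> carrier_mat (2 * g) (2 * g)"
  "dim_row (intersection_mat g) = 2 * g" "dim_col (intersection_mat g) = 2 * g"
  by (simp_all add: intersection_mat_def)

lemma intersection_mat_nth:
  assumes "i < 2 * g" "j < 2 * g"
  shows "intersection_mat g $$ (i, j) = of_bool (j = partner i)"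
proof -
  have parity: "(\<And>a. m = 2 * a \<Longrightarrow> thesis) \<Longrightarrow> (\<And>a. m = Suc (2 * a) \<Longrightarrow> thesis) \<Longrightarrow> thesis"
    for m :: nat and thesis
    by (metis evenE oddE Suc_eq_plus1)
  have "i \<noteq> j \<and> i div 2 = j div 2 \<longleftrightarrow> j = partner i"
    by (rule parity[of i]; rule parity[of j]) (auto simp: partner_def, presburger+)
  then show ?thesis using assms by (simp add: intersection_mat_def)
qed

lemma intersection_mat_mult_vec:
  assumes "v \<in> carrier_vec (2 * g)" "i < 2 * g"
  shows "(intersection_mat g *\<^sub>v v) $ i = v $ partner i"
proof -
  have "(intersection_mat g *\<^sub>v v) $ i = (\<Sum>j<2 * g. intersection_mat g $$ (i, j) * v $ j)"
    using assms
    by (simp add: scalar_prod_def atLeast0LessThan)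
  also have "\<dots> = (\<Sum>j<2 * g. if j = partner i then v $ j else 0)"
    using assms by (intro sum.cong) (auto simp: intersection_mat_nth)
  also have "\<dots> = v $ partner i"
    using partner_lt[OF assms(2)] by simp
  finally show ?thesis .
qed

lemma intersection_mat_square: "intersection_mat g * intersection_mat g = 1\<^sub>m (2 * g)"
proof (rule eq_matI)
  fix i j assume "i < dim_row (1\<^sub>m (2 * g) :: bit mat)" "j < dim_col (1\<^sub>m (2 * g) :: bit mat)"
  then have ij: "i < 2 * g" "j < 2 * g" by simp_all
  have "(intersection_mat g * intersection_mat g) $$ (i, j) =
      (intersection_mat g *\<^sub>v col (intersection_mat g) j) $ i"
    using ij by simp
  also have "\<dots> = intersection_mat g $$ (partner i, j)"
    using ij partner_lt[OF ij(1)]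
    by (subst intersection_mat_mult_vec) auto
  also have "\<dots> = of_bool (i = j)"
    using ij partner_lt[OF ij(1)]
    by (auto simp: intersection_mat_nth partner_def)
  finally show "(intersection_mat g * intersection_mat g) $$ (i, j) = 1\<^sub>m (2 * g) $$ (i, j)"
    using ij by simp
qed auto

lemma sum_pairs:
  "(\<Sum>i<2 * g. f i) = (\<Sum>k\<in>{1..g}. f (2 * k - 2) + f (2 * k - 1))" for f :: "nat \<Rightarrow> 'a::comm_monoid_add"
  by (induction g) (simp_all add: add.assoc)

lemma scalar_prod_intersection_mat:
  assumes "v \<in> carrier_vec (2 * g)" "w \<in> carrier_vec (2 * g)"
  shows "v \<bullet> (intersection_mat g *\<^sub>v w) =
    (\<Sum>k\<in>{1..g}. v $ (2 * k - 2) * w $ (2 * k - 1) + v $ (2 * k - 1) * w $ (2 * k - 2))"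
proof -
  have "v \<bullet> (intersection_mat g *\<^sub>v w) = (\<Sum>i<2 * g. v $ i * w $ partner i)"
    using assms
    unfolding scalar_prod_def
    by (auto simp: atLeast0LessThan intersection_mat_mult_vec simp del: index_mult_mat_vec intro!: sum.cong)
  also have "\<dots> = (\<Sum>k\<in>{1..g}. v $ (2 * k - 2) * w $ (2 * k - 1) + v $ (2 * k - 1) * w $ (2 * k - 2))"
  proof -
    have "partner (2 * k - 2) = 2 * k - 1" "partner (2 * k - 1) = 2 * k - 2" if "1 \<le> k" for k
      using that by (cases k; simp add: partner_def)+
    then show ?thesis
      unfolding sum_pairs by (intro sum.cong) auto
  qed
  finally show ?thesis .
qed

lemma intersection_eq_scalar_prod:
  "intersection g a b = HF.coords g a \<bullet> (intersection_mat g *\<^sub>v HF.coords g b)"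
proof -
  have "sigma_dual g (2 * k - 1) = HF.coord g (2 * k - 2)"
    "sigma_dual g (2 * k) = HF.coord g (2 * k - 1)" if "k \<in> {1..g}" for k
    using that sigma_dual_eq_coord[of g "2 * k - 2"] sigma_dual_eq_coord[of g "2 * k - 1"]
    by (simp_all add: Suc_diff_Suc numeral_2_eq_2)
  then show ?thesis
    unfolding intersection_def by (subst scalar_prod_intersection_mat) (auto intro!: sum.cong)
qed

lemma Sp_iff:
  assumes "A \<in> carrier_mat (2 * g) (2 * g)"
  shows "A \<in> Sp g \<longleftrightarrow> (\<forall>i<2 * g. \<forall>j<2 * g.
    col A i \<bullet> (intersection_mat g *\<^sub>v col A j) = intersection_mat g $$ (i, j))"
proof -
  have "A\<^sup>T * intersection_mat g * A = A\<^sup>T * (intersection_mat g * A)"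
    using assms by (intro assoc_mult_mat[of _ "2*g" "2*g" _ "2*g" _ "2*g"]) auto
  then have "(A\<^sup>T * intersection_mat g * A) $$ (i, j) = col A i \<bullet> (intersection_mat g *\<^sub>v col A j)"
    if "i < 2 * g" "j < 2 * g" for i j
    using that assms by (simp add: col_mult2[of _ "2*g" "2*g" _ "2*g"] del: assoc_mult_mat)
  then show ?thesis
    using assms unfolding Sp_def
    by (auto simp: mat_eq_iff)
qed

text \<open>
  With \<open>\<Omega>\<close> the intersection matrix, \<open>A\<^sup>T \<Omega> A = \<Omega>\<close> and \<open>\<Omega>\<^sup>2 = 1\<close> make \<open>\<Omega> A\<^sup>T \<Omega>\<close> a left inverse.
\<close>

lemma Sp_inverse:
  assumes "A \<in> Sp g"
  obtains A' where "A' \<in> carrier_mat (2 * g) (2 * g)" "A' * A = 1\<^sub>m (2 * g)" "A * A' = 1\<^sub>m (2 * g)"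
proof -
  let ?O = "intersection_mat g"
  have A: "A \<in> carrier_mat (2 * g) (2 * g)" "A\<^sup>T * ?O * A = ?O"
    using assms by (auto simp: Sp_def)
  let ?A' = "?O * (A\<^sup>T * ?O)"
  have A': "?A' \<in> carrier_mat (2 * g) (2 * g)" using A by auto
  have "?A' * A = ?O * (A\<^sup>T * ?O * A)"
    using A by (intro assoc_mult_mat[of _ "2*g" "2*g" _ "2*g" _ "2*g"]) auto
  then have "?A' * A = 1\<^sub>m (2 * g)" by (simp add: A intersection_mat_square)
  with that A A' mat_mult_left_right_inverse[OF A' A(1)] show thesis by blast
qed

lemma intersection_mat_mult_carrier [simp]: "intersection_mat g *\<^sub>v v \<in> carrier_vec (2 * g)"
  by (rule carrier_vecI) simp

lemma mat_mult_unit_vec: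
  fixes A :: "'a::semiring_1 mat"
  assumes "A \<in> carrier_mat m n" "j < n"
  shows "A *\<^sub>v unit_vec n j = col A j"
  using assms by (intro eq_vecI) auto

lemma Sp_carrier: "A \<in> Sp g \<Longrightarrow> A \<in> carrier_mat (2 * g) (2 * g)"
  by (simp add: Sp_def)

section \<open>Quadratic sections in coordinates\<close>

text \<open>
  The quadratic refinement of the intersection product that vanishes on the basis.
\<close>

definition quadratic_form :: "nat \<Rightarrow> bit vec \<Rightarrow> bit" where
  "quadratic_form g v = (\<Sum>k\<in>{1..g}. v $ (2 * k - 1) * v $ (2 * k - 2))"

lemma quadratic_form_add:
  assumes "v \<in> carrier_vec (2 * g)" "w \<in> carrier_vec (2 * g)"
  shows "quadratic_form g (v + w) =
    quadratic_form g v + quadratic_form g w + v \<bullet> (intersection_mat g *\<^sub>v w)"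
  unfolding quadratic_form_def scalar_prod_intersection_mat[OF assms] sum.distrib[symmetric]
  using assms by (intro sum.cong) (auto simp: algebra_simps)

lemma quadratic_form_unit_vec: "quadratic_form g (unit_vec (2 * g) i) = 0"
  unfolding quadratic_form_def by (intro sum.neutral) (auto simp: unit_vec_def split: if_splits)

lemma nu_Suc: "i < 2 * g \<Longrightarrow> nu g c (Suc i) = nu g c (basis_label g i)"
  and nu_0: "nu g c 0 = nu g c (basis_label g (2 * g))"
  by (simp_all add: basis_label_def)

lemma nu_closed: "i \<le> 2 * g \<Longrightarrow> nu g c i \<in> carrier (H1 (pi1_P g c))"
  using HP.e_closed[of "i - 1" g c] HP.e_closed[of "2 * g" g c] by (cases i) (auto simp: basis_label_def)

text \<open>
  Both sides are quadratic functions of \<open>a\<close> whose polarization is \<open>\<chi>(\<nu>\<^sub>0)\<close> times the intersection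
  product, and they agree on the basis \<open>\<sigma>\<^sub>1, \<dots>, \<sigma>\<^bsub>2g\<^esub>\<close>.  Applied to the coordinate forms, this
  computes \<open>s\<close>; applied to the linear maps of coverings, it yields the entries of \<open>J(A)\<close>.
\<close>

lemma hom_quadratic_section:
  assumes s: "quadratic_section g c r s" and \<chi>: "\<chi> \<in> hom (H1 (pi1_P g c)) Z2"
    and a: "a \<in> carrier (H1 (pi1_F g))"
  shows "\<chi> (s a) = (\<Sum>i<2 * g. HF.coord g i a * (\<chi> (nu g c (Suc i)) + r (Suc i) * \<chi> (nu g c 0)))
    + quadratic_form g (HF.coords g a) * \<chi> (nu g c 0)"
  using a
proof (induction rule: HF.span_induct)
  note s = s[unfolded quadratic_section_def Let_def]
  have s_closed: "s a \<in> carrier (H1 (pi1_P g c))" if "a \<in> carrier (H1 (pi1_F g))" for a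
    using s that by auto
  have add: "\<chi> (s (x \<otimes>\<^bsub>H1 (pi1_F g)\<^esub> y)) =
      \<chi> (s x) + \<chi> (s y) + (HF.coords g x \<bullet> (intersection_mat g *\<^sub>v HF.coords g y)) * \<chi> (nu g c 0)"
    if "x \<in> carrier (H1 (pi1_F g))" "y \<in> carrier (H1 (pi1_F g))" for x y
  proof -
    have "s (x \<otimes>\<^bsub>H1 (pi1_F g)\<^esub> y) = s x \<otimes>\<^bsub>H1 (pi1_P g c)\<^esub> s y
        \<otimes>\<^bsub>H1 (pi1_P g c)\<^esub> bit_scale (H1 (pi1_P g c)) (intersection g x y) (nu g c 0)"
      using s that by blast
    then show ?thesis
      using \<chi> that by (simp add: hom_Z2_iff s_closed nu_closed HP.hom_bit_scale[OF \<chi>]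
          intersection_eq_scalar_prod)
  qed
  {
    case one
    have zero: "HF.coords g \<one>\<^bsub>H1 (pi1_F g)\<^esub> = 0\<^sub>v (2 * g)"
      by (auto simp: HF.coords_def)
    have "(0\<^sub>v (2 * g) :: bit vec) \<bullet> (intersection_mat g *\<^sub>v 0\<^sub>v (2 * g)) = 0"
      by (rule scalar_prod_left_zero) (rule intersection_mat_mult_carrier)
    moreover have "quadratic_form g (0\<^sub>v (2 * g)) = 0"
      unfolding quadratic_form_def by (intro sum.neutral) auto
    ultimately show ?case
      using add[of "\<one>\<^bsub>H1 (pi1_F g)\<^esub>" "\<one>\<^bsub>H1 (pi1_F g)\<^esub>"] by (simp add: zero)
  next
    case (basis i)
    have "(\<Sum>k<2 * g. HF.coord g k (sigma g (Suc i)) * (\<chi> (nu g c (Suc k)) + r (Suc k) * \<chi> (nu g c 0)))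
        = (\<Sum>k<2 * g. if k = i then \<chi> (nu g c (Suc k)) + r (Suc k) * \<chi> (nu g c 0) else 0)"
      using basis by (intro sum.cong) auto
    also have "\<dots> = \<chi> (nu g c (Suc i)) + r (Suc i) * \<chi> (nu g c 0)"
      using basis by simp
    finally show ?case
      using s \<chi> basis by (auto simp: hom_Z2_iff nu_closed HP.hom_bit_scale[OF \<chi>] HF.coords_basis
          quadratic_form_unit_vec)
  next
    case (mult x y)
    then show ?case
      by (simp add: add HF.coords_mult quadratic_form_add sum.distrib distrib_right add.assoc
          add.left_commute add.commute)
  }
qed

definition quadratic_row :: "nat \<Rightarrow> (nat \<Rightarrow> bit) \<Rightarrow> bit mat \<Rightarrow> bit mat" where
  "quadratic_row g r A = mat 1 (2 * g) (\<lambda>(_, j).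
     (\<Sum>i<2 * g. A $$ (i, j) * r (Suc i)) + quadratic_form g (col A j) + r (Suc j))"

lemma quadratic_row_carrier [simp]: "quadratic_row g r A \<in> carrier_mat 1 (2 * g)"
  by (simp add: quadratic_row_def)

lemma J_eq_four_block:
  assumes "A \<in> carrier_mat (2 * g) (2 * g)"
  shows "J g r A = four_block_mat A (0\<^sub>m (2 * g) 1) (quadratic_row g r A) (1\<^sub>m 1)"
proof -
  have "(\<Sum>i\<in>{1..2 * g}. A $$ (i - 1, j) * r i) = (\<Sum>i<2 * g. A $$ (i, j) * r (Suc i))" for j
    by (simp add: sum.atLeast1_atMost_eq)
  then have "quadratic_row g r A = mat 1 (2 * g) (\<lambda>(_, j).
          (\<Sum>i\<in>{1..2 * g}. A $$ (i - 1, j) * r i)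
          + (\<Sum>i\<in>{1..g}. A $$ (2 * i - 1, j) * A $$ (2 * i - 2, j))
          + r (j + 1))"
    using assms unfolding quadratic_row_def quadratic_form_def by (intro eq_matI; auto intro!: sum.cong)
  then show ?thesis
    unfolding J_def by simp
qed

lemma J_carrier [simp]:
  "A \<in> carrier_mat (2 * g) (2 * g) \<Longrightarrow> J g r A \<in> carrier_mat (Suc (2 * g)) (Suc (2 * g))"
  using four_block_carrier_mat[of A "2 * g" "2 * g" "1\<^sub>m 1" 1 1] by (simp add: J_eq_four_block)

text \<open>
  \<open>J(A)\<close> is block triangular; in characteristic 2 its inverse has the lower left block
  \<open>W A\<^bsup>-1\<^esup>\<close> without a sign.
\<close>

lemma J_inverse:
  assumes "A \<in> Sp g"
  obtains M where "M \<in> carrier_mat (Suc (2 * g)) (Suc (2 * g))"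
    "M * J g r A = 1\<^sub>m (Suc (2 * g))" "J g r A * M = 1\<^sub>m (Suc (2 * g))"
proof -
  obtain A' where A': "A' \<in> carrier_mat (2 * g) (2 * g)" "A * A' = 1\<^sub>m (2 * g)"
    using Sp_inverse[OF assms] by metis
  have A: "A \<in> carrier_mat (2 * g) (2 * g)" using assms by (simp add: Sp_def)
  let ?W = "quadratic_row g r A"
  let ?M = "four_block_mat A' (0\<^sub>m (2 * g) 1) (?W * A') (1\<^sub>m 1)"
  have M: "?M \<in> carrier_mat (Suc (2 * g)) (Suc (2 * g))"
    using A' four_block_carrier_mat[of A' "2 * g" "2 * g" "1\<^sub>m 1" 1 1] by simp
  have WA: "?W * A' \<in> carrier_mat 1 (2 * g)"
    by (rule mult_carrier_mat[OF quadratic_row_carrier A'(1)])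
  have "X + X = 0\<^sub>m 1 (2 * g)" if "X \<in> carrier_mat 1 (2 * g)" for X :: "bit mat"
    using that by (intro eq_matI) auto
  from this[OF WA] have "J g r A * ?M = 1\<^sub>m (Suc (2 * g))"
    using A A' WA quadratic_row_carrier[of g r A]
    unfolding J_eq_four_block[OF A]
    by (subst mult_four_block_mat[of _ "2 * g" "2 * g" _ 1 _ 1 _ _ "2 * g" _ 1]) auto
  with that M mat_mult_left_right_inverse[OF J_carrier[OF A] M] show thesis
    by blast
qed

section \<open>The \<open>s\<close>-relation as an affine equation\<close>

definition u_row :: "nat \<Rightarrow> int \<Rightarrow> (nat free_group set \<Rightarrow> bit) \<Rightarrow> bit mat" where
  "u_row g c \<phi> = mat 1 (2 * g) (\<lambda>(_, j). \<phi> (u_gen g c (Suc j)))"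

lemma u_row_carrier [simp]: "u_row g c \<phi> \<in> carrier_mat 1 (2 * g)"
  by (simp add: u_row_def)

lemma row_equation_iff:
  assumes "A \<in> carrier_mat (2 * g) (2 * g)"
  shows "u_row g c \<phi> = u_row g c \<phi>' * A + quadratic_row g r A \<longleftrightarrow>
    (\<forall>j<2 * g. \<phi> (u_gen g c (Suc j)) =
      (\<Sum>i<2 * g. A $$ (i, j) * \<phi>' (u_gen g c (Suc i))) + quadratic_row g r A $$ (0, j))"
proof -
  have "(u_row g c \<phi>' * A) $$ (0, j) = (\<Sum>i<2 * g. A $$ (i, j) * \<phi>' (u_gen g c (Suc i)))"
    if "j < 2 * g" for j
    using assms that by (auto simp: u_row_def scalar_prod_def atLeast0LessThan mult.commute intro!: sum.cong)
  then show ?thesis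
    using assms carrier_matD[OF quadratic_row_carrier[of g r A]]
    by (auto simp: mat_eq_iff u_row_def)
qed

lemma special_coveringsD:
  assumes "\<phi> \<in> special_coverings g c"
  shows "factor (pi1_P g c) \<phi> \<in> hom (H1 (pi1_P g c)) Z2"
    and "i \<le> 2 * g \<Longrightarrow> factor (pi1_P g c) \<phi> (nu g c i) = \<phi> (u_gen g c i)"
    and "\<phi> (u_gen g c 0) = 1"
  using assms factor_hom[OF group_pi1_P, of \<phi> g c] factor_hurewicz[OF group_pi1_P, of \<phi> g c]
    u_gen_in_pi1_P
  by (auto simp: special_coverings_def nu_def)

text \<open>
  The columns of the matrix are the coordinates of the vectors \<open>f(\<sigma>\<^sub>j)\<close>, and the entries of
  \<open>A\<^sup>T \<Omega> A\<close> are their intersection products.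
\<close>

lemma symplectic_aut_matrix:
  assumes "f \<in> symplectic_auts g"
  shows "mat (2 * g) (2 * g) (\<lambda>(i, j). HF.coord g i (f (sigma g (Suc j)))) \<in> Sp g"
proof -
  let ?A = "mat (2 * g) (2 * g) (\<lambda>(i, j). HF.coord g i (f (sigma g (Suc j))))"
  have col: "col ?A j = HF.coords g (f (sigma g (Suc j)))" if "j < 2 * g" for j
    using that by auto
  have "col ?A i \<bullet> (intersection_mat g *\<^sub>v col ?A j) = intersection_mat g $$ (i, j)"
    if ij: "i < 2 * g" "j < 2 * g" for i j
  proof -
    have "col ?A i \<bullet> (intersection_mat g *\<^sub>v col ?A j) =
        intersection g (f (sigma g (Suc i))) (f (sigma g (Suc j)))"
      unfolding intersection_eq_scalar_prod col[OF ij(1)] col[OF ij(2)] ..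
    also have "\<dots> = intersection g (sigma g (Suc i)) (sigma g (Suc j))"
      using assms ij HF.e_closed by (auto simp: symplectic_auts_def)
    also have "\<dots> = intersection_mat g $$ (i, j)"
      using ij by (simp add: intersection_eq_scalar_prod HF.coords_basis scalar_prod_left_unit)
    finally show ?thesis .
  qed
  then show ?thesis by (simp add: Sp_iff)
qed

lemma Sp_preserves_intersection:
  assumes "A \<in> Sp g" "v \<in> carrier_vec (2 * g)" "w \<in> carrier_vec (2 * g)"
  shows "(A *\<^sub>v v) \<bullet> (intersection_mat g *\<^sub>v (A *\<^sub>v w)) = v \<bullet> (intersection_mat g *\<^sub>v w)"
proof -
  let ?O = "intersection_mat g"
  have A: "A \<in> carrier_mat (2 * g) (2 * g)" "A\<^sup>T * ?O * A = ?O"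
    using assms by (auto simp: Sp_def)
  have "(A *\<^sub>v v) \<bullet> (?O *\<^sub>v (A *\<^sub>v w)) = v \<bullet> (A\<^sup>T *\<^sub>v (?O *\<^sub>v (A *\<^sub>v w)))"
    using A assms transpose_vec_mult_scalar[of "A\<^sup>T" "2 * g" "2 * g" "?O *\<^sub>v (A *\<^sub>v w)" v] by simp
  also have "A\<^sup>T *\<^sub>v (?O *\<^sub>v (A *\<^sub>v w)) = (A\<^sup>T * ?O * A) *\<^sub>v w"
    using A(1) assms by (simp add: assoc_mult_mat_vec[of _ "2*g" "2*g" _ "2*g"])
  finally show ?thesis by (simp add: A(2))
qed

text \<open>
  If the coverings are \<open>s\<close>-related, comparing the values of the two linear maps at \<open>s(\<sigma>\<^sub>j)\<close> and at
  \<open>f\<^sub>s(s(\<sigma>\<^sub>j)) = s(f(\<sigma>\<^sub>j))\<close> gives the \<open>j\<close>-th entry of the equation.  Conversely, the automorphisms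
  with the matrices \<open>A\<close> and \<open>J(A)\<close> serve as \<open>f\<close> and \<open>f\<^sub>s\<close>: the row \<open>W(A)\<close> is what makes
  \<open>f\<^sub>s(s(\<sigma>\<^sub>j))\<close> equal to \<open>s(f(\<sigma>\<^sub>j))\<close> in the coordinate of \<open>\<nu>\<^sub>0\<close>.
\<close>

lemma s_related_iff:
  assumes s: "quadratic_section g c r s"
    and \<phi>: "\<phi> \<in> special_coverings g c" and \<phi>': "\<phi>' \<in> special_coverings g c"
  shows "s_related g c s \<phi> \<phi>' \<longleftrightarrow>
    (\<exists>A\<in>Sp g. u_row g c \<phi> = u_row g c \<phi>' * A + quadratic_row g r A)"
proof
  assume "s_related g c s \<phi> \<phi>'"
  then obtain f fs where f: "f \<in> symplectic_auts g" and fs: "induced_aut g c s f fs"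
    and rel: "\<And>y. y \<in> carrier (H1 (pi1_P g c)) \<Longrightarrow>
      factor (pi1_P g c) \<phi> y = factor (pi1_P g c) \<phi>' (fs y)"
    unfolding s_related_def by blast
  define A where "A = mat (2 * g) (2 * g) (\<lambda>(i, j). HF.coord g i (f (sigma g (Suc j))))"
  have A: "A \<in> Sp g" "A \<in> carrier_mat (2 * g) (2 * g)"
    using symplectic_aut_matrix[OF f] by (simp_all add: A_def)
  have "\<phi> (u_gen g c (Suc j)) =
      (\<Sum>i<2 * g. A $$ (i, j) * \<phi>' (u_gen g c (Suc i))) + quadratic_row g r A $$ (0, j)"
    if j: "j < 2 * g" for j
  proof -
    let ?\<sigma> = "sigma g (Suc j)"
    have \<sigma>: "?\<sigma> \<in> carrier (H1 (pi1_F g))" using j by simp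
    then have f\<sigma>: "f ?\<sigma> \<in> carrier (H1 (pi1_F g))"
      using f by (auto simp: symplectic_auts_def iso_def hom_def)
    have col: "HF.coords g (f ?\<sigma>) = col A j"
      using j by (auto simp: A_def)
    have entry: "HF.coord g i (f ?\<sigma>) = A $$ (i, j)" if "i < 2 * g" for i
      using that j by (simp add: A_def)
    have "\<phi> (u_gen g c (Suc j)) + r (Suc j) = factor (pi1_P g c) \<phi> (s ?\<sigma>)"
    proof -
      have "s ?\<sigma> = nu g c (Suc j) \<otimes>\<^bsub>H1 (pi1_P g c)\<^esub> bit_scale (H1 (pi1_P g c)) (r (Suc j)) (nu g c 0)"
        using s j by (auto simp: quadratic_section_def Let_def)
      then show ?thesis
        using special_coveringsD[OF \<phi>] j
        by (simp add: hom_Z2_iff nu_closed HP.hom_bit_scale)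
    qed
    also have "\<dots> = factor (pi1_P g c) \<phi>' (s (f ?\<sigma>))"
    proof -
      have "s ?\<sigma> \<in> carrier (H1 (pi1_P g c))"
        using s \<sigma> unfolding quadratic_section_def Let_def by blast
      moreover have "fs (s ?\<sigma>) = s (f ?\<sigma>)"
        using fs j by (simp add: induced_aut_def)
      ultimately show ?thesis using rel by metis
    qed
    also have "\<dots> = (\<Sum>i<2 * g. A $$ (i, j) * (\<phi>' (u_gen g c (Suc i)) + r (Suc i)))
        + quadratic_form g (col A j)"
      using special_coveringsD[OF \<phi>']
      by (simp add: hom_quadratic_section[OF s _ f\<sigma>] col entry)
    also have "\<dots> = (\<Sum>i<2 * g. A $$ (i, j) * \<phi>' (u_gen g c (Suc i)))
        + (\<Sum>i<2 * g. A $$ (i, j) * r (Suc i)) + quadratic_form g (col A j)"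
      by (simp add: distrib_left sum.distrib)
    \<comment> \<open>Adding \<open>r\<^sub>j\<close> once more cancels it on the left and completes \<open>w\<^sub>j\<close> on the right.\<close>
    finally have "\<phi> (u_gen g c (Suc j)) + r (Suc j) + r (Suc j) = \<dots> + r (Suc j)"
      by simp
    then show ?thesis
      using j by (simp add: quadratic_row_def add.assoc)
  qed
  then show "\<exists>A\<in>Sp g. u_row g c \<phi> = u_row g c \<phi>' * A + quadratic_row g r A"
    using A row_equation_iff by blast
next
  assume "\<exists>A\<in>Sp g. u_row g c \<phi> = u_row g c \<phi>' * A + quadratic_row g r A"
  then obtain A where A: "A \<in> Sp g" and row: "u_row g c \<phi> = u_row g c \<phi>' * A + quadratic_row g r A"
    by blast
  note A = A Sp_carrier[OF A]
  note eq = row[unfolded row_equation_iff[OF A(2)], rule_format]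
  \<comment> \<open>\<open>A\<close> and \<open>J(A)\<close> act as \<open>f\<close> and \<open>f\<^sub>s\<close>.\<close>
  define f where "f = HF.mat_action g A"
  define fs where "fs = HP.mat_action g c (J g r A)"
  note W = carrier_matD[OF quadratic_row_carrier[of g r A]]
  obtain A' where A': "A' \<in> carrier_mat (2 * g) (2 * g)" "A' * A = 1\<^sub>m (2 * g)" "A * A' = 1\<^sub>m (2 * g)"
    by (rule Sp_inverse[OF A(1)])
  have f: "f \<in> symplectic_auts g"
    unfolding symplectic_auts_def f_def using A A'
    by (auto simp: HF.mat_action_iso intersection_eq_scalar_prod HF.coords_mat_action
        Sp_preserves_intersection)
  obtain M where M: "M \<in> carrier_mat (Suc (2 * g)) (Suc (2 * g))"
    "M * J g r A = 1\<^sub>m (Suc (2 * g))" "J g r A * M = 1\<^sub>m (Suc (2 * g))"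
    by (rule J_inverse[OF A(1)])
  have fs_iso: "fs \<in> iso (H1 (pi1_P g c)) (H1 (pi1_P g c))"
    unfolding fs_def by (rule HP.mat_action_iso[OF J_carrier[OF A(2)] M])
  have fs_closed: "fs y \<in> carrier (H1 (pi1_P g c))" for y
    by (simp add: fs_def)
  have fs_basis: "HP.coords g c (fs (nu g c (basis_label g j))) = col (J g r A) j" if "j < Suc (2 * g)" for j
    using that HP.coords_basis[OF that]
    by (simp add: fs_def HP.coords_mat_action[OF J_carrier[OF A(2)]] mat_mult_unit_vec[OF J_carrier[OF A(2)]])
  have fs_entry: "HP.coord g c i (fs (nu g c (basis_label g j))) = J g r A $$ (i, j)"
    if "i < Suc (2 * g)" "j < Suc (2 * g)" for i j
    using that A carrier_matD[OF J_carrier[OF A(2)]]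
    by (metis HP.coords_nth fs_basis index_col)
  have fs_nu0: "fs (nu g c 0) = nu g c 0"
  proof (rule HP.coords_eqI)
    have "col (J g r A) (2 * g) = unit_vec (Suc (2 * g)) (2 * g)"
      using A W by (auto simp: J_eq_four_block unit_vec_def)
    then show "HP.coords g c (fs (nu g c 0)) = HP.coords g c (nu g c 0)"
      unfolding nu_0 using fs_basis[of "2 * g"] HP.coords_basis[of "2 * g"] by simp
  qed (simp_all add: fs_closed nu_closed)
  have add: "\<chi> (fs (x \<otimes>\<^bsub>H1 (pi1_P g c)\<^esub> y)) = \<chi> (fs x) + \<chi> (fs y)"
    if "\<chi> \<in> hom (H1 (pi1_P g c)) Z2" "x \<in> carrier (H1 (pi1_P g c))" "y \<in> carrier (H1 (pi1_P g c))" for \<chi> x y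
    using that fs_iso fs_closed by (auto simp: iso_def hom_def)
  have "fs (s (sigma g (Suc j))) = s (f (sigma g (Suc j)))" if j: "j < 2 * g" for j
  proof (rule HP.coords_eqI)
    let ?\<sigma> = "sigma g (Suc j)"
    have s_eq: "s ?\<sigma> = nu g c (Suc j) \<otimes>\<^bsub>H1 (pi1_P g c)\<^esub> bit_scale (H1 (pi1_P g c)) (r (Suc j)) (nu g c 0)"
      using s j by (auto simp: quadratic_section_def Let_def)
    have f\<sigma>: "f ?\<sigma> \<in> carrier (H1 (pi1_F g))" by (simp add: f_def)
    have col: "HF.coords g (f ?\<sigma>) = col A j"
      using j A by (simp add: f_def HF.coords_mat_action HF.coords_basis mat_mult_unit_vec)
    have entry: "HF.coord g i (f ?\<sigma>) = A $$ (i, j)" if "i < 2 * g" for i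
      using that j A by (metis HF.coords_nth col carrier_matD index_col)
    show "fs (s ?\<sigma>) \<in> carrier (H1 (pi1_P g c))" by (rule fs_closed)
    show "s (f ?\<sigma>) \<in> carrier (H1 (pi1_P g c))"
      using s f\<sigma> by (auto simp: quadratic_section_def Let_def)
    have "HP.coord g c i (fs (s ?\<sigma>)) = HP.coord g c i (s (f ?\<sigma>))" if i: "i < Suc (2 * g)" for i
    proof -
      have scale: "fs (bit_scale (H1 (pi1_P g c)) b (nu g c 0)) = bit_scale (H1 (pi1_P g c)) b (nu g c 0)" for b
        using fs_nu0 hom_one[of fs "H1 (pi1_P g c)" "H1 (pi1_P g c)"] fs_iso HP.group_axioms
        by (auto simp: bit_scale_def iso_def)
      have \<nu>0: "HP.coord g c i (nu g c 0) = of_bool (i = 2 * g)"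
        unfolding nu_0 by simp
      have \<nu>: "HP.coord g c i (nu g c (Suc k)) = of_bool (i = k)" if "k < 2 * g" for k
        unfolding nu_Suc[OF that] using that by simp
      have "HP.coord g c i (fs (s ?\<sigma>)) = J g r A $$ (i, j) + r (Suc j) * of_bool (i = 2 * g)"
        using j i unfolding s_eq
        by (simp add: add HP.coord_hom nu_closed scale HP.hom_bit_scale[OF HP.coord_hom] \<nu>0)
          (simp add: nu_Suc fs_entry)
      moreover have "HP.coord g c i (s (f ?\<sigma>)) =
          (\<Sum>k<2 * g. A $$ (k, j) * (of_bool (i = k) + r (Suc k) * of_bool (i = 2 * g)))
          + quadratic_form g (col A j) * of_bool (i = 2 * g)"
        unfolding hom_quadratic_section[OF s HP.coord_hom f\<sigma>] by (simp add: col entry \<nu> \<nu>0)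
      moreover have "J g r A $$ (i, j) + r (Suc j) * of_bool (i = 2 * g) = \<dots>"
      proof (cases "i = 2 * g")
        case True
        then show ?thesis
          using j A W by (simp add: J_eq_four_block quadratic_row_def add.assoc)
      next
        case False
        then have "(\<Sum>k<2 * g. A $$ (k, j) * (of_bool (i = k) + r (Suc k) * of_bool (i = 2 * g))) =
            (\<Sum>k<2 * g. if k = i then A $$ (k, j) else 0)"
          by (intro sum.cong) auto
        then show ?thesis
          using j i False A W by (simp add: J_eq_four_block)
      qed
      ultimately show ?thesis by simp
    qed
    then show "HP.coords g c (fs (s ?\<sigma>)) = HP.coords g c (s (f ?\<sigma>))"
      by (auto simp: HP.coords_def)
  qed
  then have "fs (s (sigma g i)) = s (f (sigma g i))" if "i \<in> {1..2 * g}" for i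
    using that by (cases i) auto
  with fs_iso fs_nu0 have induced: "induced_aut g c s f fs"
    by (simp add: induced_aut_def)
  have "factor (pi1_P g c) \<phi> y = (factor (pi1_P g c) \<phi>' \<circ> fs) y"
    if "y \<in> carrier (H1 (pi1_P g c))" for y
  proof (rule HP.hom_eqI[OF _ _ _ that])
    show "factor (pi1_P g c) \<phi> \<in> hom (H1 (pi1_P g c)) Z2"
      by (rule special_coveringsD[OF \<phi>])
    show "factor (pi1_P g c) \<phi>' \<circ> fs \<in> hom (H1 (pi1_P g c)) Z2"
      using fs_iso special_coveringsD(1)[OF \<phi>'] by (auto simp: iso_def intro: hom_compose)
    fix j assume j: "j < Suc (2 * g)"
    show "factor (pi1_P g c) \<phi> (nu g c (basis_label g j)) =
        (factor (pi1_P g c) \<phi>' \<circ> fs) (nu g c (basis_label g j))"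
    proof (cases "j = 2 * g")
      case True
      then show ?thesis
        using special_coveringsD[OF \<phi>] special_coveringsD[OF \<phi>'] by (simp add: fs_nu0 flip: nu_0)
    next
      case False
      then have j: "j < 2 * g" using j by simp
      have "factor (pi1_P g c) \<phi>' (fs (nu g c (basis_label g j))) =
          (\<Sum>i<Suc (2 * g). HP.coord g c i (fs (nu g c (basis_label g j)))
            * factor (pi1_P g c) \<phi>' (nu g c (basis_label g i)))"
        by (rule HP.hom_expand[OF special_coveringsD(1)[OF \<phi>'] fs_closed])
      also have "\<dots> = (\<Sum>i<2 * g. A $$ (i, j) * \<phi>' (u_gen g c (Suc i))) + quadratic_row g r A $$ (0, j)"
      proof -
        have "factor (pi1_P g c) \<phi>' (nu g c (basis_label g i)) = \<phi>' (u_gen g c (Suc i))"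
          if "i < 2 * g" for i
          using special_coveringsD(2)[OF \<phi>'] that by (simp flip: nu_Suc)
        moreover have "factor (pi1_P g c) \<phi>' (nu g c (basis_label g (2 * g))) = 1"
          using special_coveringsD(2,3)[OF \<phi>'] by (simp flip: nu_0)
        ultimately show ?thesis
          using j A W by (simp add: fs_entry J_eq_four_block)
      qed
      finally show ?thesis
        using eq[OF j] special_coveringsD[OF \<phi>] j by (simp flip: nu_Suc)
    qed
  qed
  then show "s_related g c s \<phi> \<phi>'"
    unfolding s_related_def using f induced by auto
qed

section \<open>Fox derivatives over the group ring of order two\<close>

lemma group_ring_map_zero [simp]: "group_ring_map h 0 = 0"
  by (simp add: group_ring_map_def)

lemma group_ring_map_single_one [simp]:
  "group_ring_map h (Poly_Mapping.single w 1) = Poly_Mapping.single (h w) 1"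
  by (simp add: group_ring_map_def)

lemma group_ring_map_add: "group_ring_map h (a + b) = group_ring_map h a + group_ring_map h b"
  unfolding group_ring_map_def
  by (rule setsum_keys_plus_distrib) (simp_all add: single_add)

lemma group_ring_map_diff: "group_ring_map h (a - b) = group_ring_map h a - group_ring_map h b"
  by (metis add_diff_cancel_right' diff_add_cancel group_ring_map_add)

lemma group_ring_map_one: "h 0 = 0 \<Longrightarrow> group_ring_map h 1 = 1"
  by (simp add: group_ring_map_def)

lemma group_ring_map_single_mult:
  assumes "\<And>x. h (w + x) = h w + h x"
  shows "group_ring_map h (Poly_Mapping.single w 1 * b) =
    Poly_Mapping.single (h w) 1 * group_ring_map h b"
  using subset_UNIV[of "Poly_Mapping.keys b"]
proof (induction b rule: frag_induction)
  case (one x)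
  then show ?case by (simp add: mult_single assms)
next
  case (diff a b)
  then show ?case by (simp add: right_diff_distrib group_ring_map_diff)
qed simp_all

lemma group_ring_map_cong:
  "(\<And>w. w \<in> Poly_Mapping.keys a \<Longrightarrow> h w = h' w) \<Longrightarrow> group_ring_map h a = group_ring_map h' a"
  unfolding group_ring_map_def by (intro sum.cong) auto

lemma fox_zero [simp]: "fox j 0 = 0"
  using fox_add[of j 0 0] by simp

lemma fox_uminus: "fox j (- a) = - (Poly_Mapping.single (- a) 1 * fox j a)"
  using fox_add[of j "- a" a] by (simp add: eq_neg_iff_add_eq_0)

text \<open>
  By the product rule, the words in a Fox derivative are prefixes of an expression of the given word in
  the generators.
\<close>

lemma keys_fox:
  assumes "w \<in> carrier (free_group_on I)"
  shows "Poly_Mapping.keys (fox j w) \<subseteq> carrier (free_group_on I)"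
proof -
  have keys_single_mult: "Poly_Mapping.keys (Poly_Mapping.single v 1 * p) \<subseteq> carrier (free_group_on I)"
    if "v \<in> carrier (free_group_on I)" "Poly_Mapping.keys p \<subseteq> carrier (free_group_on I)"
    for v and p :: "'a free_group \<Rightarrow>\<^sub>0 int"
    using that keys_mult[of "Poly_Mapping.single v 1" p] add_in_free_group_on
    by (fastforce split: if_splits)
  have gen: "Poly_Mapping.keys (fox j (gen i)) \<subseteq> carrier (free_group_on I)" for i
    by (simp add: fox_gen zero_in_free_group_on)
  show ?thesis
    using assms[folded generate_free_group_on]
  proof (induction rule: generate.induct)
    case one
    then show ?case by simp
  next
    case (incl h)
    then show ?case using gen by auto
  next
    case (inv h)
    then obtain i where i: "i \<in> I" "h = gen i" by auto
    then show ?case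
      using keys_single_mult[OF uminus_in_free_group_on[OF gen_in_free_group_on] gen]
      by (simp add: inv_free_group_on gen_in_free_group_on fox_uminus)
  next
    case (eng h1 h2)
    then show ?case
      using keys_single_mult[of h1 "fox j h2"] keys_add[of "fox j h1"]
      by (fastforce simp: fox_add generate_free_group_on)
  qed
qed

lemma Z2Z2_add_self [simp]: "(x :: Z2Z2) + x = 0"
  by (rule poly_mapping_eqI) (simp only: lookup_add bit_add_self lookup_zero)

lemma Z2Z2_two [simp]: "(2 :: Z2Z2) = 0"
  unfolding one_add_one[symmetric] by (rule Z2Z2_add_self)

lemma Z2Z2_uminus [simp]: "- (x :: Z2Z2) = x"
  using Z2Z2_add_self[of x] unfolding neg_eq_iff_add_eq_0 .

text \<open>
  \<open>1 + t\<close>, the sum of all elements of the group of order 2.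
\<close>

definition norm_elt :: Z2Z2 where
  "norm_elt = 1 + Poly_Mapping.single 1 1"

abbreviation const :: "bit \<Rightarrow> Z2Z2" where
  "const \<equiv> Poly_Mapping.single 0"

interpretation const: inj_semiring_hom const
proof
  show "x = y" if "const x = const y" for x y
    using that by (metis lookup_single_eq)
qed (simp_all add: single_add mult_single)

lemma one_plus_power: "1 + Poly_Mapping.single b 1 = norm_elt * const b"
  by (cases b) (simp_all add: norm_elt_def)

text \<open>
  The coefficient of the neutral element in \<open>(1 + t) z\<close> is \<open>z\<close>.
\<close>

lemma norm_elt_mult_const_inject: "norm_elt * const x = norm_elt * const y \<longleftrightarrow> x = y"
proof -
  have "Poly_Mapping.lookup (norm_elt * const z) 0 = z" for z
    by (simp add: norm_elt_def distrib_right mult_single lookup_add lookup_single_not_eq)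
  then show ?thesis by metis
qed

text \<open>
  The Fox derivative \<open>\<partial>w/\<partial>u\<^sub>j\<close>, pushed to the group ring of \<open>\<int>\<^sub>2\<close> along the homomorphism with the values
  \<open>v\<close> on the generators.
\<close>

definition fox_Z2 :: "('a \<Rightarrow> bit) \<Rightarrow> 'a \<Rightarrow> 'a free_group \<Rightarrow> Z2Z2" where
  "fox_Z2 v j w = group_ring_map (free_eval v) (fox j w)"

lemma fox_Z2_zero [simp]: "fox_Z2 v j 0 = 0"
  by (simp add: fox_Z2_def)

lemma fox_Z2_gen: "fox_Z2 v j (gen i) = of_bool (i = j)"
  by (simp add: fox_Z2_def fox_gen group_ring_map_one)

lemma fox_Z2_add:
  "fox_Z2 v j (a + b) = fox_Z2 v j a + Poly_Mapping.single (free_eval v a) 1 * fox_Z2 v j b"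
  by (simp add: fox_Z2_def fox_add group_ring_map_add group_ring_map_single_mult)

lemma fox_Z2_uminus:
  "fox_Z2 v j (- a) = Poly_Mapping.single (free_eval v a) 1 * fox_Z2 v j a"
proof -
  have "fox_Z2 v j (- a) + Poly_Mapping.single (free_eval v a) 1 * fox_Z2 v j a = 0"
    using fox_Z2_add[of v j "- a" a] by simp
  then show ?thesis by (simp add: add_eq_0_iff)
qed

text \<open>
  In a commutative group ring the product rule gives \<open>(1 - b) \<partial>a + (a - 1) \<partial>b\<close> for the derivative of
  \<open>a b a\<^bsup>-1\<^esup> b\<^bsup>-1\<^esup>\<close>; here \<open>1 - a\<close> is \<open>0\<close> or \<open>1 + t\<close>.
\<close>

lemma fox_Z2_comm:
  "fox_Z2 v j (comm a b) =
    norm_elt * const (free_eval v b) * fox_Z2 v j a + norm_elt * const (free_eval v a) * fox_Z2 v j b"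
proof -
  let ?t = "\<lambda>x. Poly_Mapping.single x 1 :: Z2Z2"
  have "comm a b = a + (b + (- a + - b))"
    by (simp add: comm_def diff_conv_add_uminus add.assoc del: add_uminus_conv_diff)
  then have "fox_Z2 v j (comm a b) = fox_Z2 v j a + ?t (free_eval v a) * (fox_Z2 v j b
      + ?t (free_eval v b) * (?t (free_eval v a) * fox_Z2 v j a
        + ?t (free_eval v a) * (?t (free_eval v b) * fox_Z2 v j b)))"
    by (simp add: fox_Z2_add fox_Z2_uminus del: add_uminus_conv_diff)
  also have "\<dots> = (1 + ?t (free_eval v b)) * fox_Z2 v j a + (1 + ?t (free_eval v a)) * fox_Z2 v j b"
    by (cases "free_eval v a"; cases "free_eval v b")
      (simp_all add: algebra_simps mult_single flip: mult.assoc)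
  finally show ?thesis by (simp add: one_plus_power)
qed

text \<open>
  Factors with trivial image leave the derivatives of the later factors unchanged.
\<close>

lemma fox_Z2_sum_list:
  assumes "\<And>x. x \<in> set xs \<Longrightarrow> free_eval v (f x) = 0"
  shows "fox_Z2 v j (\<Sum>x\<leftarrow>xs. f x) = (\<Sum>x\<leftarrow>xs. fox_Z2 v j (f x))"
  using assms by (induction xs) (simp_all add: fox_Z2_add)

lemma fox_Z2_surface_word:
  "fox_Z2 v j (surface_word g) =
    (\<Sum>i<2 * g. norm_elt * const (v (Suc (partner i))) * of_bool (Suc i = j))"
proof -
  have "fox_Z2 v j (surface_word g) =
      (\<Sum>l\<in>{1..g}. norm_elt * const (v (2 * l)) * of_bool (2 * l - 1 = j)
        + norm_elt * const (v (2 * l - 1)) * of_bool (2 * l = j))"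
    by (simp add: surface_word_def fox_Z2_sum_list fox_Z2_comm fox_Z2_gen
        sum_list_distinct_conv_sum_set atLeastLessThanSuc_atLeastAtMost del: upt_Suc)
  also have "\<dots> = (\<Sum>i<2 * g. norm_elt * const (v (Suc (partner i))) * of_bool (Suc i = j))"
  proof -
    have "partner (2 * k - 2) = 2 * k - 1" "partner (2 * k - 1) = 2 * k - 2"
      "Suc (2 * k - 2) = 2 * k - 1" "Suc (2 * k - 1) = 2 * k" if "1 \<le> k" for k
      using that by (cases k; simp add: partner_def)+
    then show ?thesis
      unfolding sum_pairs by (intro sum.cong) auto
  qed
  finally show ?thesis .
qed

text \<open>
  \<open>a\<close> is sent to \<open>t\<close>, so the powers \<open>1, a, \<dots>, a\<^bsup>2c-1\<^esup>\<close> in the derivative sum up to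
  \<open>c (1 + t)\<close>; for negative \<open>c\<close>, inverting a word with trivial image only changes the sign.
\<close>

lemma fox_Z2_zpow_even:
  assumes "free_eval v a = 1"
  shows "fox_Z2 v j (zpow a (2 * c)) = norm_elt * const (of_int c) * fox_Z2 v j a"
proof -
  have *: "free_eval v (sum_list (replicate (2 * m) a)) = 0 \<and>
    fox_Z2 v j (sum_list (replicate (2 * m) a)) = norm_elt * const (of_nat m) * fox_Z2 v j a" for m
  proof (induction m)
    case (Suc m)
    let ?t = "Poly_Mapping.single 1 1 :: Z2Z2" and ?D = "fox_Z2 v j a"
    let ?X = "norm_elt * const (of_nat m) * ?D"
    have "fox_Z2 v j (sum_list (replicate (2 * Suc m) a)) = ?D + ?t * (?D + ?t * ?X)"
      using Suc by (simp add: fox_Z2_add assms)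
    also have "?t * (?D + ?t * ?X) = ?t * ?D + ?X"
    proof -
      have "?t * ?t = 1" by (simp add: mult_single)
      then show ?thesis by (simp add: distrib_left flip: mult.assoc)
    qed
    also have "?D + (?t * ?D + ?X) = norm_elt * ?D + ?X"
      by (simp add: norm_elt_def distrib_right add.assoc)
    also have "\<dots> = norm_elt * const (of_nat (Suc m)) * ?D"
      by (simp add: single_add distrib_left distrib_right)
    finally show ?case using Suc by (simp add: assms flip: add.assoc)
  qed simp
  show ?thesis
  proof (cases "0 \<le> c")
    case True
    have "nat (2 * c) = 2 * nat c" by simp
    then show ?thesis
      using True *[of "nat c"] by (simp add: zpow_def)
  next
    case False
    have "nat (- (2 * c)) = 2 * nat (- c)" by simp
    moreover have "(of_nat (nat (- c)) :: bit) = of_int c"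
      using False of_int_of_nat_eq[of "nat (- c)", where 'a = bit] by simp
    ultimately show ?thesis
      using False *[of "nat (- c)"] by (simp add: zpow_def fox_Z2_uminus)
  qed
qed

section \<open>The derived matrix\<close>

text \<open>
  The column \<open>\<epsilon>\<close> of the derived matrix: its entry at a generator is the entry of \<open>n\<close> at the dual
  generator.
\<close>

definition dual_col :: "nat \<Rightarrow> bit mat \<Rightarrow> bit mat" where
  "dual_col g n = intersection_mat g * n\<^sup>T"

lemma dual_col_carrier [simp]: "n \<in> carrier_mat 1 (2 * g) \<Longrightarrow> dual_col g n \<in> carrier_mat (2 * g) 1"
  unfolding dual_col_def by (intro mult_carrier_mat[of _ _ "2 * g"]) auto

lemma dual_col_nth:
  assumes "n \<in> carrier_mat 1 (2 * g)" "i < 2 * g"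
  shows "dual_col g n $$ (i, 0) = n $$ (0, partner i)"
proof -
  have row: "row n 0 \<in> carrier_vec (2 * g)"
    using assms row_carrier[of n 0] by simp
  have "dual_col g n $$ (i, 0) = (intersection_mat g *\<^sub>v row n 0) $ i"
    using assms by (simp add: dual_col_def)
  also have "\<dots> = n $$ (0, partner i)"
    using assms partner_lt[OF assms(2)] by (simp only: intersection_mat_mult_vec[OF row assms(2)]) simp
  finally show ?thesis .
qed

text \<open>
  The intersection product is alternating.
\<close>

lemma mult_dual_col_self:
  assumes "n \<in> carrier_mat 1 (2 * g)"
  shows "n * dual_col g n = 0\<^sub>m 1 1"
proof -
  have row: "row n 0 \<in> carrier_vec (2 * g)"
    using assms row_carrier[of n 0] by simp
  have "col (dual_col g n) 0 = intersection_mat g *\<^sub>v row n 0"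
    unfolding dual_col_def using assms by (subst col_mult2[of _ "2 * g" "2 * g" _ 1]) auto
  then have "(n * dual_col g n) $$ (0, 0) = row n 0 \<bullet> (intersection_mat g *\<^sub>v row n 0)"
    using assms dual_col_carrier[OF assms] by simp
  also have "\<dots> = 0"
    unfolding scalar_prod_intersection_mat[OF row row] by (simp add: mult.commute)
  finally show ?thesis
    using assms dual_col_carrier[OF assms] by (intro eq_matI) auto
qed

definition coefficient_mat :: "nat \<Rightarrow> int \<Rightarrow> bit mat \<Rightarrow> bit mat" where
  "coefficient_mat g c n =
    four_block_mat (1\<^sub>m (2 * g)) (dual_col g n) n (mat 1 1 (\<lambda>_. of_int c))"

lemma derived_matrix_eq:
  assumes \<phi>: "\<phi> \<in> special_coverings g c"
  shows "derived_matrix g c \<phi> = norm_elt \<cdot>\<^sub>m map_mat const (coefficient_mat g c (u_row g c \<phi>))"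
proof -
  define v where "v = (\<lambda>i. \<phi> (u_gen g c i))"
  let ?n = "u_row g c \<phi>"
  have v0: "v 0 = 1" using special_coveringsD(3)[OF \<phi>] by (simp add: v_def)
  have \<phi>_hom: "\<phi> \<in> hom (presented_group {0..2 * g} (relator g c ` {0..2 * g})) Z2"
    using \<phi> by (simp add: special_coverings_def pi1_P_def)
  have eval: "\<phi> (pi1_P_class g c w) = free_eval v w" if "w \<in> carrier (free_group_on {0..2 * g})" for w
    using presented_group_hom_eq_free_eval[OF relators_in_free_group_on \<phi>_hom that]
    by (simp add: pi1_P_class_def u_gen_def v_def[abs_def])
  have entry: "group_ring_map (\<lambda>w. \<phi> (pi1_P_class g c w)) (fox j (relator g c i)) = fox_Z2 v j (relator g c i)"
    if "i \<le> 2 * g" for i j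
    unfolding fox_Z2_def using keys_fox[OF relator_in_free_group_on[OF that]] eval
    by (intro group_ring_map_cong) auto
  have n: "?n $$ (0, i) = v (Suc i)" if "i < 2 * g" for i
    using that by (simp add: u_row_def v_def)
  have n_carrier: "?n \<in> carrier_mat 1 (2 * g)" "dim_row ?n = 1" "dim_col ?n = 2 * g"
    by (simp_all add: u_row_def)
  have dual: "dual_col g ?n $$ (i, 0) = v (Suc (partner i))" if "i < 2 * g" for i
    using partner_lt[OF that] by (simp only: dual_col_nth[OF n_carrier(1) that] n)
  have dual_dim: "dim_row (dual_col g ?n) = 2 * g" "dim_col (dual_col g ?n) = 1"
    using dual_col_carrier[OF n_carrier(1)] by auto
  have surface_0: "fox_Z2 v 0 (surface_word g) = 0"
    by (simp add: fox_Z2_surface_word)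
  have surface_Suc: "fox_Z2 v (Suc j) (surface_word g) = norm_elt * const (v (Suc (partner j)))"
    if "j < 2 * g" for j
  proof -
    have "fox_Z2 v (Suc j) (surface_word g) =
        (\<Sum>i<2 * g. if i = j then norm_elt * const (v (Suc (partner i))) else 0)"
      unfolding fox_Z2_surface_word by (intro sum.cong) auto
    then show ?thesis using that by simp
  qed
  have "fox_Z2 v (basis_label g j) (relator g c (basis_label g i)) =
      norm_elt * const (coefficient_mat g c ?n $$ (j, i))"
    if "j < 2 * g + 1" "i < 2 * g + 1" for i j
  proof (cases "i < 2 * g")
    case True
    then show ?thesis
      using that n_carrier dual_dim
      by (cases "j < 2 * g")
        (auto simp: coefficient_mat_def basis_label_def relator_def fox_Z2_comm fox_Z2_gen v0 n)
  next
    case False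
    then have "i = 2 * g" using that by simp
    then show ?thesis
      using that n_carrier dual_dim
      by (cases "j < 2 * g")
        (simp_all add: coefficient_mat_def basis_label_def relator_def fox_Z2_add fox_Z2_zpow_even
          fox_Z2_gen v0 surface_0 surface_Suc dual)
  qed
  moreover have "basis_label g i \<le> 2 * g" if "i < 2 * g + 1" for i
    using that by (simp add: basis_label_def)
  ultimately show ?thesis
    using n_carrier dual_dim
    by (intro eq_matI) (auto simp: derived_matrix_def entry coefficient_mat_def)
qed

section \<open>Module automorphisms and matrices\<close>

text \<open>
  Linearity is applied to the truncations \<open>p k\<close> of \<open>v\<close>, which add one basis vector at a time.
\<close>

lemma module_aut_eq_mult_matrix_of:
  fixes f :: "'a::comm_ring_1 vec \<Rightarrow> 'a vec"
  assumes f: "module_aut n f" and v: "v \<in> carrier_vec n"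
  shows "f v = matrix_of n f *\<^sub>v v"
proof -
  have closed: "f w \<in> carrier_vec n" if "w \<in> carrier_vec n" for w
    using f that by (auto simp: module_aut_def bij_betw_def)
  have add: "f (w + w') = f w + f w'" if "w \<in> carrier_vec n" "w' \<in> carrier_vec n" for w w'
    using f that by (simp add: module_aut_def)
  have smult: "f (a \<cdot>\<^sub>v w) = a \<cdot>\<^sub>v f w" if "w \<in> carrier_vec n" for a w
    using f that by (simp add: module_aut_def)
  define p where "p k = vec n (\<lambda>i. if i < k then v $ i else 0)" for k
  have "f (p k) = vec n (\<lambda>i. \<Sum>j<k. f (unit_vec n j) $ i * v $ j)" if "k \<le> n" for k
    using that
  proof (induction k)
    case 0
    have "p 0 = 0 \<cdot>\<^sub>v 0\<^sub>v n" by (auto simp: p_def)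
    then have "f (p 0) = 0 \<cdot>\<^sub>v f (0\<^sub>v n)" by (simp only: smult zero_carrier_vec)
    then show ?case using closed[of "0\<^sub>v n"] by (auto intro!: eq_vecI)
  next
    case (Suc k)
    have "p (Suc k) = p k + v $ k \<cdot>\<^sub>v unit_vec n k"
      using Suc.prems by (auto simp: p_def unit_vec_def less_Suc_eq)
    then have "f (p (Suc k)) = f (p k) + v $ k \<cdot>\<^sub>v f (unit_vec n k)"
      by (simp add: add smult p_def)
    also have "\<dots> = vec n (\<lambda>i. \<Sum>j<Suc k. f (unit_vec n j) $ i * v $ j)"
      using Suc closed[of "unit_vec n k"] by (intro eq_vecI) (auto simp: mult.commute)
    finally show ?case .
  qed
  from this[of n] have "f (p n) = vec n (\<lambda>i. \<Sum>j<n. f (unit_vec n j) $ i * v $ j)" by simp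
  moreover have "p n = v" using v by (auto simp: p_def)
  moreover have "matrix_of n f *\<^sub>v v = vec n (\<lambda>i. \<Sum>j<n. f (unit_vec n j) $ i * v $ j)"
    using v by (intro eq_vecI) (auto simp: matrix_of_def scalar_prod_def atLeast0LessThan intro!: sum.cong)
  ultimately show ?thesis by simp
qed

lemma module_aut_mult_mat:
  fixes A :: "'a::comm_ring_1 mat"
  assumes A: "A \<in> carrier_mat n n" "B \<in> carrier_mat n n" and inv: "A * B = 1\<^sub>m n" "B * A = 1\<^sub>m n"
  shows "module_aut n (\<lambda>v. A *\<^sub>v v)"
  unfolding module_aut_def
proof (intro conjI ballI allI)
  have "A *\<^sub>v (B *\<^sub>v v) = v" "B *\<^sub>v (A *\<^sub>v v) = v" if "v \<in> carrier_vec n" for v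
    using that A inv by (simp_all flip: assoc_mult_mat_vec[of _ n n _ n])
  then show "bij_betw (\<lambda>v. A *\<^sub>v v) (carrier_vec n) (carrier_vec n)"
    using A by (intro bij_betw_byWitness[where f' = "\<lambda>v. B *\<^sub>v v"]) auto
qed (use A in \<open>auto simp: mult_add_distrib_mat_vec[of _ n n] mult_mat_vec[of _ n n]\<close>)

lemma matrix_of_mult_mat:
  fixes A :: "'a::comm_ring_1 mat"
  assumes A: "A \<in> carrier_mat n n"
  shows "matrix_of n (\<lambda>v. A *\<^sub>v v) = A"
  using A by (intro eq_matI) (auto simp: matrix_of_def mat_mult_unit_vec)

lemma mat_eqI_mult_vec:
  fixes A B :: "'a::semiring_1 mat"
  assumes "A \<in> carrier_mat m n" "B \<in> carrier_mat m n"
    and "\<And>v. v \<in> carrier_vec n \<Longrightarrow> A *\<^sub>v v = B *\<^sub>v v"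
  shows "A = B"
proof (rule mat_col_eqI)
  fix j assume "j < dim_col B"
  then have "j < n" using assms by simp
  then show "col A j = col B j"
    using assms(1,2) assms(3)[of "unit_vec n j"] by (simp add: mat_mult_unit_vec)
qed (use assms in auto)

lemma four_block_mat_inject:
  assumes "A \<in> carrier_mat m n" "A' \<in> carrier_mat m n" "B \<in> carrier_mat m k" "B' \<in> carrier_mat m k"
    "C \<in> carrier_mat l n" "C' \<in> carrier_mat l n" "D \<in> carrier_mat l k" "D' \<in> carrier_mat l k"
  shows "four_block_mat A B C D = four_block_mat A' B' C' D' \<longleftrightarrow> A = A' \<and> B = B' \<and> C = C' \<and> D = D'"
proof
  assume eq: "four_block_mat A B C D = four_block_mat A' B' C' D'"
  have entry: "four_block_mat A B C D $$ (i, j) = four_block_mat A' B' C' D' $$ (i, j)" for i j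
    by (simp only: eq)
  have "A $$ (i, j) = A' $$ (i, j)" if "i < m" "j < n" for i j
    using entry[of i j] that assms by simp
  moreover have "B $$ (i, j) = B' $$ (i, j)" if "i < m" "j < k" for i j
    using entry[of i "n + j"] that assms by simp
  moreover have "C $$ (i, j) = C' $$ (i, j)" if "i < l" "j < n" for i j
    using entry[of "m + i" j] that assms by simp
  moreover have "D $$ (i, j) = D' $$ (i, j)" if "i < l" "j < k" for i j
    using entry[of "m + i" "n + j"] that assms by simp
  ultimately show "A = A' \<and> B = B' \<and> C = C' \<and> D = D'"
    using assms by (auto intro!: eq_matI)
qed simp

lemma upper_block_mult:
  fixes A A' B B' :: "'a::comm_semiring_1 mat"
  assumes "A \<in> carrier_mat m m" "A' \<in> carrier_mat m m" "B \<in> carrier_mat m 1" "B' \<in> carrier_mat m 1"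
  shows "four_block_mat A B (0\<^sub>m 1 m) (1\<^sub>m 1) * four_block_mat A' B' (0\<^sub>m 1 m) (1\<^sub>m 1) =
    four_block_mat (A * A') (A * B' + B) (0\<^sub>m 1 m) (1\<^sub>m 1)"
  using assms mult_carrier_mat[OF assms(1,2)] mult_carrier_mat[OF assms(1,4)]
  by (subst mult_four_block_mat[of _ m m _ 1 _ 1 _ _ m _ 1]) simp_all

lemma map_mat_const_zero: "map_mat const (0\<^sub>m m n) = 0\<^sub>m m n"
  by (intro eq_matI) auto

section \<open>Congruence as an affine equation\<close>

lemma bit_mat_add_self: "X \<in> carrier_mat m n \<Longrightarrow> X + X = 0\<^sub>m m n" for X :: "bit mat"
  by (intro eq_matI) auto

lemma bit_mat_add_cancel:
  fixes X Y :: "bit mat"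
  assumes "X \<in> carrier_mat m n" "Y \<in> carrier_mat m n"
  shows "X + Y + Y = X"
  using assms by (intro eq_matI) (auto simp: add.assoc)

lemma coefficient_mat_carrier:
  "n \<in> carrier_mat 1 (2 * g) \<Longrightarrow> coefficient_mat g c n \<in> carrier_mat (2 * g + 1) (2 * g + 1)"
  unfolding coefficient_mat_def by (rule four_block_carrier_mat) auto

lemma norm_elt_smult_const_inject:
  assumes "X \<in> carrier_mat m n" "Y \<in> carrier_mat m n"
  shows "norm_elt \<cdot>\<^sub>m map_mat const X = norm_elt \<cdot>\<^sub>m map_mat const Y \<longleftrightarrow> X = Y"
  using assms by (auto simp: mat_eq_iff norm_elt_mult_const_inject)

lemma J_mult_coefficient_mat:
  assumes A: "A \<in> carrier_mat (2 * g) (2 * g)" and n: "n \<in> carrier_mat 1 (2 * g)"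
  shows "J g r A * coefficient_mat g c n =
    four_block_mat A (A * dual_col g n) (quadratic_row g r A + n)
      (quadratic_row g r A * dual_col g n + mat 1 1 (\<lambda>_. of_int c))"
proof -
  note E = dual_col_carrier[OF n]
  have "A * dual_col g n \<in> carrier_mat (2 * g) 1" "quadratic_row g r A * dual_col g n \<in> carrier_mat 1 1"
    by (rule mult_carrier_mat[OF A E], rule mult_carrier_mat[OF quadratic_row_carrier E])
  then show ?thesis
    unfolding J_eq_four_block[OF A] coefficient_mat_def
    using A n E quadratic_row_carrier[of g r A]
    by (subst mult_four_block_mat[of _ "2 * g" "2 * g" _ 1 _ 1 _ _ "2 * g" _ 1]) simp_all
qed

lemma coefficient_mat_mult_block:
  fixes B1 B2 :: "Z2Z2 mat"
  assumes n: "n \<in> carrier_mat 1 (2 * g)"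
    and B: "B1 \<in> carrier_mat (2 * g) (2 * g)" "B2 \<in> carrier_mat (2 * g) 1"
  shows "map_mat const (coefficient_mat g c n) * four_block_mat B1 B2 (0\<^sub>m 1 (2 * g)) (1\<^sub>m 1) =
    four_block_mat B1 (B2 + map_mat const (dual_col g n)) (map_mat const n * B1)
      (map_mat const n * B2 + map_mat const (mat 1 1 (\<lambda>_. of_int c)))"
proof -
  have E: "map_mat const (dual_col g n) \<in> carrier_mat (2 * g) 1"
    using dual_col_carrier[OF n] by simp
  have N: "map_mat const n \<in> carrier_mat 1 (2 * g)" using n by simp
  have "map_mat const n * B1 \<in> carrier_mat 1 (2 * g)" "map_mat const n * B2 \<in> carrier_mat 1 1"
    by (rule mult_carrier_mat[OF N B(1)], rule mult_carrier_mat[OF N B(2)])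
  moreover have "map_mat const (coefficient_mat g c n) =
      four_block_mat (1\<^sub>m (2 * g)) (map_mat const (dual_col g n)) (map_mat const n)
        (map_mat const (mat 1 1 (\<lambda>_. of_int c)))"
    unfolding coefficient_mat_def using n dual_col_carrier[OF n]
    by (subst map_four_block_mat[of _ "2 * g" "2 * g" _ 1 _ 1]) (simp_all add: const.mat_hom_one)
  ultimately show ?thesis
    using N B E
    by (simp add: mult_four_block_mat[of _ "2 * g" "2 * g" _ 1 _ 1 _ _ "2 * g" _ 1])
qed

text \<open>
  The choice of the upper blocks of \<open>\<theta>\<close> settles the upper blocks of the equation, and the hypothesis
  is its lower left block.  In the lower right corner \<open>W \<epsilon>\<close> has to agree with
  \<open>n' (A \<epsilon> + \<epsilon>')\<close>; they differ by \<open>n \<epsilon> + n' \<epsilon>'\<close>, which vanishes.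
\<close>

lemma congruence_blocks:
  assumes A: "A \<in> carrier_mat (2 * g) (2 * g)"
    and n: "n \<in> carrier_mat 1 (2 * g)" and n': "n' \<in> carrier_mat 1 (2 * g)"
    and eq: "n = n' * A + quadratic_row g r A"
  shows "J g r A * coefficient_mat g c n = coefficient_mat g c n' *
    four_block_mat A (A * dual_col g n + dual_col g n') (0\<^sub>m 1 (2 * g)) (1\<^sub>m 1)"
proof -
  let ?W = "quadratic_row g r A" and ?E = "dual_col g n" and ?E' = "dual_col g n'"
    and ?C = "mat 1 1 (\<lambda>_. of_int c) :: bit mat"
  note E = dual_col_carrier[OF n] and E' = dual_col_carrier[OF n']
  note W = quadratic_row_carrier[of g r A]
  have AE: "A * ?E \<in> carrier_mat (2 * g) 1" by (rule mult_carrier_mat[OF A E])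
  have n'A: "n' * A \<in> carrier_mat 1 (2 * g)" by (rule mult_carrier_mat[OF n' A])
  have n'A_eq: "n' * A = ?W + n"
    using bit_mat_add_cancel[OF n'A W] comm_add_mat[OF W n] by (simp add: eq)
  have "n' * (A * ?E + ?E') = n' * (A * ?E) + n' * ?E'"
    by (rule mult_add_distrib_mat[OF n' AE E'])
  also have "\<dots> = n' * A * ?E"
    unfolding mult_dual_col_self[OF n'] assoc_mult_mat[OF n' A E, symmetric]
    by (rule right_add_zero_mat) (rule mult_carrier_mat[OF n'A E])
  also have "\<dots> = ?W * ?E + n * ?E"
    unfolding n'A_eq by (rule add_mult_distrib_mat[OF W n E])
  also have "\<dots> = ?W * ?E"
    unfolding mult_dual_col_self[OF n] by (rule right_add_zero_mat) (rule mult_carrier_mat[OF W E])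
  finally have corner: "n' * (A * ?E + ?E') = ?W * ?E" .
  have B2: "A * ?E + ?E' \<in> carrier_mat (2 * g) 1" using AE E' by simp
  have "coefficient_mat g c n' * four_block_mat A (A * ?E + ?E') (0\<^sub>m 1 (2 * g)) (1\<^sub>m 1) =
      four_block_mat A (A * ?E + ?E' + ?E') (n' * A) (n' * (A * ?E + ?E') + ?C)"
    unfolding coefficient_mat_def
    using A n' E' B2 n'A mult_carrier_mat[OF n' B2]
    by (subst mult_four_block_mat[of _ "2 * g" "2 * g" _ 1 _ 1 _ _ "2 * g" _ 1]) simp_all
  also have "\<dots> = J g r A * coefficient_mat g c n"
    unfolding J_mult_coefficient_mat[OF A n] corner bit_mat_add_cancel[OF AE E'] n'A_eq ..
  finally show ?thesis by simp
qed

text \<open>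
  From a congruence, the upper left blocks give \<open>(1 + t) B\<^sub>1 = (1 + t) A\<close>.  The matrix \<open>B\<^sub>1\<close> itself
  need not have entries in \<open>\<int>\<^sub>2\<close>, but in the lower left block it occurs only together with the
  factor \<open>1 + t\<close>, and can be replaced by \<open>A\<close>.
\<close>

lemma congruent_derived_iff:
  assumes \<phi>: "\<phi> \<in> special_coverings g c" and \<phi>': "\<phi>' \<in> special_coverings g c"
  shows "congruent_derived g c r \<phi> \<phi>' \<longleftrightarrow>
    (\<exists>A\<in>Sp g. u_row g c \<phi> = u_row g c \<phi>' * A + quadratic_row g r A)"
proof -
  let ?k = "2 * g + 1"
  let ?n = "u_row g c \<phi>" and ?n' = "u_row g c \<phi>'"
  let ?M = "coefficient_mat g c ?n" and ?M' = "coefficient_mat g c ?n'"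
  let ?D = "derived_matrix g c \<phi>" and ?D' = "derived_matrix g c \<phi>'"
  note n = u_row_carrier[of g c \<phi>] and n' = u_row_carrier[of g c \<phi>']
  note M = coefficient_mat_carrier[OF n, of c] and M' = coefficient_mat_carrier[OF n', of c]
  note D = derived_matrix_eq[OF \<phi>] and D' = derived_matrix_eq[OF \<phi>']
  have D_carrier: "?D \<in> carrier_mat ?k ?k" "?D' \<in> carrier_mat ?k ?k"
    by (simp_all add: derived_matrix_def)
  have JA_carrier: "J g r A \<in> carrier_mat ?k ?k" if "A \<in> carrier_mat (2 * g) (2 * g)" for A
    using J_carrier[OF that] by simp
  show ?thesis
  proof
    assume "congruent_derived g c r \<phi> \<phi>'"
    then obtain \<psi> \<theta> A B1 B2 where \<psi>: "module_aut ?k \<psi>" and \<theta>: "module_aut ?k \<theta>"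
      and comm: "\<And>v. v \<in> carrier_vec ?k \<Longrightarrow> \<psi> (?D *\<^sub>v v) = ?D' *\<^sub>v \<theta> v"
      and A: "A \<in> Sp g" and \<psi>_mat: "matrix_of ?k \<psi> = map_mat const (J g r A)"
      and B: "B1 \<in> carrier_mat (2 * g) (2 * g)" "B2 \<in> carrier_mat (2 * g) 1"
      and \<theta>_mat: "matrix_of ?k \<theta> = four_block_mat B1 B2 (0\<^sub>m 1 (2 * g)) (1\<^sub>m 1)"
      unfolding congruent_derived_def by blast
    let ?T = "four_block_mat B1 B2 (0\<^sub>m 1 (2 * g)) (1\<^sub>m 1) :: Z2Z2 mat"
    have A': "A \<in> carrier_mat (2 * g) (2 * g)" by (rule Sp_carrier[OF A])
    note W = quadratic_row_carrier[of g r A]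
    note J = JA_carrier[OF A']
    have T: "?T \<in> carrier_mat ?k ?k"
      by (rule four_block_carrier_mat) (use B in auto)
    have cJ: "map_mat const (J g r A) \<in> carrier_mat ?k ?k" using J by simp
    have cM: "map_mat const ?M \<in> carrier_mat ?k ?k" "map_mat const ?M' \<in> carrier_mat ?k ?k"
      using M M' by simp_all
    have "map_mat const (J g r A) * ?D = ?D' * ?T"
    proof (rule mat_eqI_mult_vec)
      fix v :: "Z2Z2 vec" assume v: "v \<in> carrier_vec ?k"
      have "(map_mat const (J g r A) * ?D) *\<^sub>v v = map_mat const (J g r A) *\<^sub>v (?D *\<^sub>v v)"
        by (rule assoc_mult_mat_vec[OF cJ D_carrier(1) v])
      also have "\<dots> = \<psi> (?D *\<^sub>v v)"
        using module_aut_eq_mult_matrix_of[OF \<psi>, of "?D *\<^sub>v v"] mult_mat_vec_carrier[OF D_carrier(1) v]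
        by (simp only: \<psi>_mat)
      also have "\<dots> = ?D' *\<^sub>v (?T *\<^sub>v v)"
        using comm[OF v] module_aut_eq_mult_matrix_of[OF \<theta> v] by (simp only: \<theta>_mat)
      also have "\<dots> = (?D' * ?T) *\<^sub>v v"
        by (rule assoc_mult_mat_vec[OF D_carrier(2) T v, symmetric])
      finally show "(map_mat const (J g r A) * ?D) *\<^sub>v v = (?D' * ?T) *\<^sub>v v" .
    qed (rule mult_carrier_mat[OF cJ D_carrier(1)], rule mult_carrier_mat[OF D_carrier(2) T])
    then have "norm_elt \<cdot>\<^sub>m (map_mat const (J g r A) * map_mat const ?M) =
        norm_elt \<cdot>\<^sub>m (map_mat const ?M' * ?T)"
      unfolding D D' mult_smult_distrib[OF cJ cM(1)] mult_smult_assoc_mat[OF cM(2) T] .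
    then have "norm_elt \<cdot>\<^sub>m map_mat const (J g r A * ?M) = norm_elt \<cdot>\<^sub>m (map_mat const ?M' * ?T)"
      unfolding const.mat_hom_mult[OF J M] .
    moreover have "norm_elt \<cdot>\<^sub>m map_mat const (J g r A * ?M) = four_block_mat
        (norm_elt \<cdot>\<^sub>m map_mat const A) (norm_elt \<cdot>\<^sub>m map_mat const (A * dual_col g ?n))
        (norm_elt \<cdot>\<^sub>m map_mat const (quadratic_row g r A + ?n))
        (norm_elt \<cdot>\<^sub>m map_mat const (quadratic_row g r A * dual_col g ?n + mat 1 1 (\<lambda>_. of_int c)))"
      unfolding J_mult_coefficient_mat[OF A' n]
      using A' W n mult_carrier_mat[OF A' dual_col_carrier[OF n]]
        mult_carrier_mat[OF W dual_col_carrier[OF n]]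
      by (simp add: map_four_block_mat[of _ "2 * g" "2 * g" _ 1 _ 1]
          smult_four_block_mat[of _ "2 * g" "2 * g" _ 1 _ 1])
    moreover have "norm_elt \<cdot>\<^sub>m (map_mat const ?M' * ?T) = four_block_mat
        (norm_elt \<cdot>\<^sub>m B1) (norm_elt \<cdot>\<^sub>m (B2 + map_mat const (dual_col g ?n')))
        (norm_elt \<cdot>\<^sub>m (map_mat const ?n' * B1))
        (norm_elt \<cdot>\<^sub>m (map_mat const ?n' * B2 + map_mat const (mat 1 1 (\<lambda>_. of_int c))))"
      unfolding coefficient_mat_mult_block[OF n' B]
      using B n' mult_carrier_mat[of "map_mat const ?n'" 1 "2 * g" B1 "2 * g"]
        mult_carrier_mat[of "map_mat const ?n'" 1 "2 * g" B2 1] dual_col_carrier[OF n']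
      by (simp add: smult_four_block_mat[of _ "2 * g" "2 * g" _ 1 _ 1])
    ultimately have B1: "norm_elt \<cdot>\<^sub>m map_mat const A = norm_elt \<cdot>\<^sub>m B1"
      and row: "norm_elt \<cdot>\<^sub>m map_mat const (quadratic_row g r A + ?n) =
        norm_elt \<cdot>\<^sub>m (map_mat const ?n' * B1)"
      using A' W n n' B mult_carrier_mat[of "map_mat const ?n'" 1 "2 * g" B1 "2 * g"]
        mult_carrier_mat[of "map_mat const ?n'" 1 "2 * g" B2 1] dual_col_carrier[OF n']
        mult_carrier_mat[OF A' dual_col_carrier[OF n]] mult_carrier_mat[OF W dual_col_carrier[OF n]]
      by (simp_all add: four_block_mat_inject[of _ "2 * g" "2 * g" _ _ 1 _ _ 1])
    have cn': "map_mat const ?n' \<in> carrier_mat 1 (2 * g)" and cA: "map_mat const A \<in> carrier_mat (2 * g) (2 * g)"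
      using n' A' by simp_all
    have n'A: "?n' * A \<in> carrier_mat 1 (2 * g)" by (rule mult_carrier_mat[OF n' A'])
    have "norm_elt \<cdot>\<^sub>m (map_mat const ?n' * B1) = map_mat const ?n' * (norm_elt \<cdot>\<^sub>m map_mat const A)"
      unfolding B1 by (rule mult_smult_distrib[OF cn' B(1), symmetric])
    also have "\<dots> = norm_elt \<cdot>\<^sub>m map_mat const (?n' * A)"
      unfolding mult_smult_distrib[OF cn' cA] const.mat_hom_mult[OF n' A'] ..
    finally have "quadratic_row g r A + ?n = ?n' * A"
      using row W n n'A by (simp add: norm_elt_smult_const_inject[of _ 1 "2 * g"])
    then have "?n = ?n' * A + quadratic_row g r A"
      using bit_mat_add_cancel[OF n W] comm_add_mat[OF W n] by simp
    then show "\<exists>A\<in>Sp g. ?n = ?n' * A + quadratic_row g r A"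
      using A by blast
  next
    assume "\<exists>A\<in>Sp g. ?n = ?n' * A + quadratic_row g r A"
    then obtain A where A: "A \<in> Sp g" and eq: "?n = ?n' * A + quadratic_row g r A" by blast
    have A': "A \<in> carrier_mat (2 * g) (2 * g)" by (rule Sp_carrier[OF A])
    note J = JA_carrier[OF A']
    let ?B = "A * dual_col g ?n + dual_col g ?n'"
    let ?T = "four_block_mat A ?B (0\<^sub>m 1 (2 * g)) (1\<^sub>m 1)"
    have AE: "A * dual_col g ?n \<in> carrier_mat (2 * g) 1"
      by (rule mult_carrier_mat[OF A' dual_col_carrier[OF n]])
    have B: "?B \<in> carrier_mat (2 * g) 1" using AE dual_col_carrier[OF n'] by simp
    have T: "?T \<in> carrier_mat ?k ?k"
      by (rule four_block_carrier_mat) (use A' in auto)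
    obtain Ai where Ai: "Ai \<in> carrier_mat (2 * g) (2 * g)" "Ai * A = 1\<^sub>m (2 * g)" "A * Ai = 1\<^sub>m (2 * g)"
      by (rule Sp_inverse[OF A])
    have AiB: "Ai * ?B \<in> carrier_mat (2 * g) 1" by (rule mult_carrier_mat[OF Ai(1) B])
    let ?Ti = "four_block_mat Ai (Ai * ?B) (0\<^sub>m 1 (2 * g)) (1\<^sub>m 1)"
    have Ti: "?Ti \<in> carrier_mat ?k ?k"
      by (rule four_block_carrier_mat) (use Ai in auto)
    have "?Ti * ?T = four_block_mat (Ai * A) (Ai * ?B + Ai * ?B) (0\<^sub>m 1 (2 * g)) (1\<^sub>m 1)"
      by (rule upper_block_mult[OF Ai(1) A' AiB B])
    also have "\<dots> = 1\<^sub>m ?k"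
      unfolding Ai(2) bit_mat_add_self[OF AiB] by (rule four_block_one_mat)
    finally have TiT: "?Ti * ?T = 1\<^sub>m ?k" .
    have TTi: "?T * ?Ti = 1\<^sub>m ?k" by (rule mat_mult_left_right_inverse[OF Ti T TiT])
    obtain Ji where Ji: "Ji \<in> carrier_mat ?k ?k" "Ji * J g r A = 1\<^sub>m ?k" "J g r A * Ji = 1\<^sub>m ?k"
      using J_inverse[OF A] by (metis Suc_eq_plus1)
    let ?\<psi> = "\<lambda>v. map_mat const (J g r A) *\<^sub>v v" and ?\<theta> = "\<lambda>v. map_mat const ?T *\<^sub>v v"
    have const_aut: "module_aut ?k (\<lambda>v. map_mat const X *\<^sub>v v)"
      if "X \<in> carrier_mat ?k ?k" "Y \<in> carrier_mat ?k ?k" "X * Y = 1\<^sub>m ?k" "Y * X = 1\<^sub>m ?k" for X Y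
    proof (rule module_aut_mult_mat)
      show "map_mat const X * map_mat const Y = 1\<^sub>m ?k" "map_mat const Y * map_mat const X = 1\<^sub>m ?k"
        using that const.mat_hom_mult[OF that(1,2)] const.mat_hom_mult[OF that(2,1)]
        by (simp_all only: const.mat_hom_one)
    qed (use that in simp_all)
    have cJ: "map_mat const (J g r A) \<in> carrier_mat ?k ?k" and cT: "map_mat const ?T \<in> carrier_mat ?k ?k"
      using J T by simp_all
    have cM: "map_mat const ?M \<in> carrier_mat ?k ?k" "map_mat const ?M' \<in> carrier_mat ?k ?k"
      using M M' by simp_all
    have "map_mat const (J g r A) * ?D = ?D' * map_mat const ?T"
      unfolding D D' mult_smult_distrib[OF cJ cM(1)] mult_smult_assoc_mat[OF cM(2) cT]
        const.mat_hom_mult[OF J M, symmetric] const.mat_hom_mult[OF M' T, symmetric]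
        congruence_blocks[OF A' n n' eq] ..
    then have comm: "?\<psi> (?D *\<^sub>v v) = ?D' *\<^sub>v ?\<theta> v" if "v \<in> carrier_vec ?k" for v
      using assoc_mult_mat_vec[OF cJ D_carrier(1) that] assoc_mult_mat_vec[OF D_carrier(2) cT that] by simp
    have "map_mat const ?T = four_block_mat (map_mat const A) (map_mat const ?B) (0\<^sub>m 1 (2 * g)) (1\<^sub>m 1)"
      using A' B by (subst map_four_block_mat[of _ "2 * g" "2 * g" _ 1 _ 1])
        (simp_all add: const.mat_hom_one map_mat_const_zero)
    then have "\<exists>B1\<in>carrier_mat (2 * g) (2 * g). \<exists>B2\<in>carrier_mat (2 * g) 1.
        matrix_of ?k ?\<theta> = four_block_mat B1 B2 (0\<^sub>m 1 (2 * g)) (1\<^sub>m 1)"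
      using A' B unfolding matrix_of_mult_mat[OF cT]
      by (intro bexI[of _ "map_mat const A"] bexI[of _ "map_mat const ?B"]) simp_all
    moreover have "matrix_of ?k ?\<psi> \<in> (\<lambda>A. map_mat const (J g r A)) ` Sp g"
      unfolding matrix_of_mult_mat[OF cJ] using A by blast
    moreover have "module_aut ?k ?\<psi>" by (rule const_aut[OF J Ji(1,3,2)])
    moreover have "module_aut ?k ?\<theta>" by (rule const_aut[OF T Ti TTi TiT])
    ultimately show "congruent_derived g c r \<phi> \<phi>'"
      unfolding congruent_derived_def using comm by blast
  qed
qed

theorem theorem33:
  fixes g :: nat and c :: int
    and r :: "nat \<Rightarrow> bit"
    and s :: "nat free_group set set \<Rightarrow> nat free_group set set"
    and \<phi> \<phi>' :: "nat free_group set \<Rightarrow> bit"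
  assumes "g \<ge> 1"
    and "quadratic_section g c r s"
    and "\<phi> \<in> special_coverings g c" and "\<phi>' \<in> special_coverings g c"
  shows "s_related g c s \<phi> \<phi>' \<longleftrightarrow> congruent_derived g c r \<phi> \<phi>'"
  using s_related_iff[OF assms(2-4)] congruent_derived_iff[OF assms(3,4)] by simp

end
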